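(* Let $X$ be a perfect Hausdorff uniform space and let $G$ be a subgroup of $\mathrm{Aut}(X)$. Then $(X,G)$ is amenable if and only if the following holds: for every $\theta \in [0,1)$, every finite subset $E \subseteq G$, and every finite uniform covering $\mathcal{U}$ of $X$, there exists a finite non-empty subset $F \subseteq X$ such that $$\forall g \in E \colon \quad \mu(F,g(F),\mathcal{U}) \geq \theta |F| .$$
   Context: Uniform spaces (covering definition): for families $\mathcal{U},\mathcal{V}$ of subsets of a set $X$, write $\mathcal{U}\preceq\mathcal{V}$ if every $V\in\mathcal{V}$ is contained in some $U\in\mathcal{U}$. For $S\subseteq X$ let $\mathrm{St}(S,\mathcal{U})=\bigcup\{U\in\mathcal{U}: U\cap S\neq\emptyset\}$, $\mathrm{St}(x,\mathcal{U})=\mathrm{St}(\{x\},\mathcal{U})$, and $\mathcal{U}^*=\{\mathrm{St}(U,\mathcal{U}):U\in\mathcal{U}\}$. A uniformity on $X$ is a non-empty set $\mathcal{D}$ of coverings of $X$ such that (1) if $\mathcal{U}\in\mathcal{D}$ and $\mathcal{V}$ is a covering with $\mathcal{V}\preceq\mathcal{U}$ then $\mathcal{V}\in\mathcal{D}$; (2) for all $\mathcal{U},\mathcal{V}\in\mathcal{D}$ there is $\mathcal{W}\in\mathcal{D}$ with $\mathcal{U}\preceq\mathcal{W}^*$ and $\mathcal{V}\preceq\mathcal{W}^*$. A uniform space is a non-empty set with a uniformity; members of the uniformity are called uniform coverings. A set $S\subseteq X$ is open if for each $x\in S$ there is a uniform covering $\mathcal{U}$ with $\mathrm{St}(x,\mathcal{U})\subseteq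 S$. A map is uniformly continuous if preimages of uniform coverings are uniform coverings; $\mathrm{Aut}(X)$ is the group of bijections of $X$ that are uniformly continuous in both directions. $\mathbb{R}$ carries its metric uniformity, and ${\rm UC}_b(X)$ is the space of bounded uniformly continuous functions $X\to\mathbb{R}$. A space is perfect if it has no isolated points. Amenability: a mean on $X$ is a linear map $\nu\colon{\rm UC}_b(X)\to\mathbb{R}$ with $\inf_X f\le\nu(f)\le\sup_X f$ for all $f$. For a subgroup $G\le\mathrm{Aut}(X)$, $(X,G)$ is amenable if there is a mean $\nu$ on $X$ with $\nu(f\circ g)=\nu(f)$ for all $f\in{\rm UC}_b(X)$, $g\in G$. Matching number: for a covering $\mathcal{U}$ of $X$ and finite $E,F\subseteq X$, $\mu(E,F,\mathcal{U})$ is the maximal cardinality of the domain $D\subseteq E$ of an injective map $\phi\colon D\to F$ such that for every $x\in D$ there is $U\in\mathcal{U}$ with $\{x,\phi(x)\}\subseteq U$. *)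

theory Defs
  imports "HOL-Analysis.Analysis" "HOL-Algebra.Bij"
begin

definition covering :: "'a set \<Rightarrow> 'a set set \<Rightarrow> bool" where
  "covering X \<U> \<longleftrightarrow> \<U> \<subseteq> Pow X \<and> \<Union>\<U> = X"

text \<open>The order is directed so that the larger family is the finer one.\<close>

definition refined_by :: "'a set set \<Rightarrow> 'a set set \<Rightarrow> bool"  (infix "\<preceq>\<^sub>c" 50) where
  "\<U> \<preceq>\<^sub>c \<V> \<longleftrightarrow> (\<forall>V\<in>\<V>. \<exists>U\<in>\<U>. V \<subseteq> U)"

definition star :: "'a set \<Rightarrow> 'a set set \<Rightarrow> 'a set" where
  "star S \<U> = \<Union>{U \<in> \<U>. U \<inter> S \<noteq> {}}"

definition star_family :: "'a set set \<Rightarrow> 'a set set" where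
  "star_family \<U> = (\<lambda>U. star U \<U>) ` \<U>"

definition covering_uniformity :: "'a set \<Rightarrow> 'a set set set \<Rightarrow> bool" where
  "covering_uniformity X \<D> \<longleftrightarrow>
     \<D> \<noteq> {} \<and> (\<forall>\<U>\<in>\<D>. covering X \<U>) \<and>
     (\<forall>\<U>\<in>\<D>. \<forall>\<V>. covering X \<V> \<and> \<V> \<preceq>\<^sub>c \<U> \<longrightarrow> \<V> \<in> \<D>) \<and>
     (\<forall>\<U>\<in>\<D>. \<forall>\<V>\<in>\<D>. \<exists>\<W>\<in>\<D>. \<U> \<preceq>\<^sub>c star_family \<W> \<and> \<V> \<preceq>\<^sub>c star_family \<W>)"

definition covering_uniform_space :: "'a set \<Rightarrow> 'a set set set \<Rightarrow> bool" where
  "covering_uniform_space X \<D> \<longleftrightarrow> X \<noteq> {} \<and> covering_uniformity X \<D>"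

definition uniform_open :: "'a set \<Rightarrow> 'a set set set \<Rightarrow> 'a set \<Rightarrow> bool" where
  "uniform_open X \<D> S \<longleftrightarrow> S \<subseteq> X \<and> (\<forall>x\<in>S. \<exists>\<U>\<in>\<D>. star {x} \<U> \<subseteq> S)"

definition uniform_topology :: "'a set \<Rightarrow> 'a set set set \<Rightarrow> 'a topology" where
  "uniform_topology X \<D> = topology (uniform_open X \<D>)"

lemma istopology_uniform_open:
  assumes "covering_uniformity X \<D>"
  shows "istopology (uniform_open X \<D>)"
  unfolding istopology_def
proof (intro conjI allI impI)
  fix S T assume S: "uniform_open X \<D> S" and T: "uniform_open X \<D> T"
  show "uniform_open X \<D> (S \<inter> T)"
    unfolding uniform_open_def
  proof (intro conjI ballI)
    show "S \<inter> T \<subseteq> X" using S by (auto simp: uniform_open_def)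
    fix x assume x: "x \<in> S \<inter> T"
    obtain \<U> where U: "\<U> \<in> \<D>" "star {x} \<U> \<subseteq> S"
      using S x unfolding uniform_open_def by blast
    obtain \<V> where V: "\<V> \<in> \<D>" "star {x} \<V> \<subseteq> T"
      using T x unfolding uniform_open_def by blast
    obtain \<W> where W: "\<W> \<in> \<D>" "\<U> \<preceq>\<^sub>c star_family \<W>" "\<V> \<preceq>\<^sub>c star_family \<W>"
      using assms U V unfolding covering_uniformity_def by meson
    have "star {x} \<W> \<subseteq> star {x} \<A>" if A: "\<A> \<preceq>\<^sub>c star_family \<W>" for \<A>
    proof
      fix y assume "y \<in> star {x} \<W>"
      then obtain w where w: "w \<in> \<W>" "x \<in> w" "y \<in> w" unfolding star_def by auto
      obtain B where B: "B \<in> \<A>" "star w \<W> \<subseteq> B"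
        using A w unfolding refined_by_def star_family_def by blast
      have "w \<subseteq> star w \<W>" using w unfolding star_def by auto
      then have "x \<in> B" "y \<in> B" using B(2) w by auto
      then show "y \<in> star {x} \<A>" using B(1) unfolding star_def by blast
    qed
    then show "\<exists>\<U>\<in>\<D>. star {x} \<U> \<subseteq> S \<inter> T" using U V W by blast
  qed
next
  fix \<K> assume "\<forall>K\<in>\<K>. uniform_open X \<D> K"
  then show "uniform_open X \<D> (\<Union>\<K>)"
    unfolding uniform_open_def
  proof (intro conjI ballI)
    assume K: "\<forall>K\<in>\<K>. K \<subseteq> X \<and> (\<forall>x\<in>K. \<exists>\<U>\<in>\<D>. star {x} \<U> \<subseteq> K)"
    show "\<Union>\<K> \<subseteq> X" using K by blast
    fix x assume "x \<in> \<Union>\<K>"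
    then obtain K where "K \<in> \<K>" "x \<in> K" by blast
    with K obtain \<U> where "\<U> \<in> \<D>" "star {x} \<U> \<subseteq> K" by blast
    with \<open>K \<in> \<K>\<close> show "\<exists>\<U>\<in>\<D>. star {x} \<U> \<subseteq> \<Union>\<K>" by blast
  qed
qed

lemma openin_uniform_topology:
  assumes "covering_uniformity X \<D>"
  shows "openin (uniform_topology X \<D>) S \<longleftrightarrow> uniform_open X \<D> S"
  unfolding uniform_topology_def
  using istopology_uniform_open[OF assms] by (simp add: topology_inverse')

lemma topspace_uniform_topology:
  assumes "covering_uniformity X \<D>"
  shows "topspace (uniform_topology X \<D>) = X"
proof -
  obtain \<U> where U: "\<U> \<in> \<D>" "covering X \<U>"
    using assms unfolding covering_uniformity_def by blast
  then have "star {x} \<U> \<subseteq> X" for x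
    unfolding covering_def star_def by blast
  with U have "uniform_open X \<D> X"
    unfolding uniform_open_def by blast
  then show ?thesis
    unfolding topspace_def openin_uniform_topology[OF assms] by (auto simp: uniform_open_def)
qed

definition perfect_space :: "'a topology \<Rightarrow> bool" where
  "perfect_space T \<longleftrightarrow> (\<forall>x\<in>topspace T. \<not> openin T {x})"

definition uniformly_continuous_covering ::
    "'a set \<Rightarrow> 'a set set set \<Rightarrow> 'b set \<Rightarrow> 'b set set set \<Rightarrow> ('a \<Rightarrow> 'b) \<Rightarrow> bool" where
  "uniformly_continuous_covering X \<D> Y \<E> f \<longleftrightarrow>
     f \<in> X \<rightarrow> Y \<and> (\<forall>\<V>\<in>\<E>. (\<lambda>V. f -` V \<inter> X) ` \<V> \<in> \<D>)"

definition metric_covering_uniformity :: "'a::metric_space set set set" where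
  "metric_covering_uniformity =
     {\<U>. covering UNIV \<U> \<and> (\<exists>\<epsilon>>0. \<forall>x. \<exists>U\<in>\<U>. ball x \<epsilon> \<subseteq> U)}"

text \<open>Maps defined on \<open>X\<close> are represented by their extensional representatives, as in
  \<^const>\<open>BijGroup\<close>, so that equality of maps is equality on \<open>X\<close>.\<close>

definition Aut :: "'a set \<Rightarrow> 'a set set set \<Rightarrow> ('a \<Rightarrow> 'a) monoid" where
  "Aut X \<D> = (BijGroup X)\<lparr>carrier :=
     {g \<in> Bij X. uniformly_continuous_covering X \<D> X \<D> g \<and>
                 uniformly_continuous_covering X \<D> X \<D> (inv_into X g)}\<rparr>"

lemma uniformly_continuous_covering_cong:
  assumes "\<And>x. x \<in> X \<Longrightarrow> f x = g x"
  shows "uniformly_continuous_covering X \<D> Y \<E> f \<longleftrightarrow> uniformly_continuous_covering X \<D> Y \<E> g"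
proof -
  have "f -` V \<inter> X = g -` V \<inter> X" for V using assms by auto
  moreover have "f \<in> X \<rightarrow> Y \<longleftrightarrow> g \<in> X \<rightarrow> Y" using assms by (simp add: Pi_def)
  ultimately show ?thesis unfolding uniformly_continuous_covering_def by simp
qed

lemma uniformly_continuous_covering_comp:
  assumes f: "uniformly_continuous_covering X \<D> Y \<E> f"
    and g: "uniformly_continuous_covering Y \<E> Z \<F> g"
  shows "uniformly_continuous_covering X \<D> Z \<F> (g \<circ> f)"
  unfolding uniformly_continuous_covering_def
proof (intro conjI ballI)
  have fY: "f \<in> X \<rightarrow> Y" using f by (simp add: uniformly_continuous_covering_def)
  show "g \<circ> f \<in> X \<rightarrow> Z"
    using f g by (auto simp: uniformly_continuous_covering_def)
  fix \<V> assume "\<V> \<in> \<F>"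
  then have "(\<lambda>V. f -` V \<inter> X) ` (\<lambda>V. g -` V \<inter> Y) ` \<V> \<in> \<D>"
    using f g by (simp add: uniformly_continuous_covering_def)
  moreover have "f -` (g -` V \<inter> Y) \<inter> X = (g \<circ> f) -` V \<inter> X" for V
    using fY by auto
  ultimately show "(\<lambda>V. (g \<circ> f) -` V \<inter> X) ` \<V> \<in> \<D>"
    by (simp add: image_image)
qed

lemma uniformly_continuous_covering_id:
  assumes "covering_uniformity X \<D>"
  shows "uniformly_continuous_covering X \<D> X \<D> (\<lambda>x. x)"
  unfolding uniformly_continuous_covering_def
proof (intro conjI ballI)
  fix \<V> assume V: "\<V> \<in> \<D>"
  then have "covering X \<V>" using assms by (simp add: covering_uniformity_def)
  then have "V \<inter> X = V" if "V \<in> \<V>" for V using that unfolding covering_def by blast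
  then have "(\<lambda>V. (\<lambda>x. x) -` V \<inter> X) ` \<V> = \<V>" by simp
  with V show "(\<lambda>V. (\<lambda>x. x) -` V \<inter> X) ` \<V> \<in> \<D>" by simp
qed simp

lemma group_Aut:
  assumes "covering_uniformity X \<D>"
  shows "group (Aut X \<D>)"
proof -
  let ?c = "\<lambda>g. uniformly_continuous_covering X \<D> X \<D> g"
  let ?A = "{g \<in> Bij X. ?c g \<and> ?c (inv_into X g)}"
  interpret group "BijGroup X" by (rule group_BijGroup)
  have c_inv: "?c (\<lambda>x\<in>X. inv_into X g x) \<longleftrightarrow> ?c (inv_into X g)" for g
    by (rule uniformly_continuous_covering_cong) simp
  have inv: "(\<lambda>x\<in>X. inv_into X g x) \<in> ?A" if "g \<in> ?A" for g
  proof -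
    have gB: "g \<in> Bij X" and bij: "bij_betw g X X" using that by (auto simp: Bij_def)
    have *: "(\<lambda>x\<in>X. inv_into X g x) \<in> Bij X" by (rule restrict_inv_into_Bij[OF gB])
    have "inv_into X (\<lambda>x\<in>X. inv_into X g x) x = g x" if "x \<in> X" for x
    proof (rule inv_into_f_eq)
      show "inj_on (\<lambda>x\<in>X. inv_into X g x) X" using * by (simp add: Bij_def bij_betw_def)
      show "g x \<in> X" using bij that by (rule bij_betwE[rule_format])
      then show "(\<lambda>x\<in>X. inv_into X g x) (g x) = x"
        using bij that by (simp add: bij_betw_def)
    qed
    then have "?c (inv_into X (\<lambda>x\<in>X. inv_into X g x)) \<longleftrightarrow> ?c g"
      by (rule uniformly_continuous_covering_cong)
    then show ?thesis using that * c_inv by simp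
  qed
  have "subgroup ?A (BijGroup X)"
  proof (rule subgroupI)
    show "?A \<subseteq> carrier (BijGroup X)" by (auto simp: BijGroup_def)
    have "?c (\<lambda>x\<in>X. x) \<longleftrightarrow> ?c (\<lambda>x. x)"
      by (rule uniformly_continuous_covering_cong) simp
    moreover have "?c (inv_into X (\<lambda>x\<in>X. x)) \<longleftrightarrow> ?c (\<lambda>x. x)"
      by (rule uniformly_continuous_covering_cong) (simp add: inv_into_f_eq inj_on_def)
    ultimately have "(\<lambda>x\<in>X. x) \<in> ?A"
      using uniformly_continuous_covering_id[OF assms] id_Bij by auto
    then show "?A \<noteq> {}" by blast
  next
    fix a assume a: "a \<in> ?A"
    then have "inv\<^bsub>BijGroup X\<^esub> a = (\<lambda>x\<in>X. inv_into X a x)" by (simp add: inv_BijGroup)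
    with inv[OF a] show "inv\<^bsub>BijGroup X\<^esub> a \<in> ?A" by (simp del: mem_Collect_eq)
  next
    fix a b assume a: "a \<in> ?A" and b: "b \<in> ?A"
    then have B: "a \<in> Bij X" "b \<in> Bij X" by auto
    have ab: "compose X a b \<in> Bij X" using B by (rule compose_Bij)
    have bij: "bij_betw a X X" "bij_betw b X X" using B by (auto simp: Bij_def)
    have "?c (compose X a b) \<longleftrightarrow> ?c (a \<circ> b)"
      by (rule uniformly_continuous_covering_cong) (simp add: compose_def)
    moreover have "inv_into X (compose X a b) x = (inv_into X b \<circ> inv_into X a) x"
      if x: "x \<in> X" for x
    proof (rule inv_into_f_eq)
      have ax: "inv_into X a x \<in> X" using bij(1) x by (metis bij_betw_def inv_into_into)
      then have bx: "inv_into X b (inv_into X a x) \<in> X"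
        using bij(2) by (metis bij_betw_def inv_into_into)
      show "inj_on (compose X a b) X" using ab by (simp add: Bij_def bij_betw_def)
      show "(inv_into X b \<circ> inv_into X a) x \<in> X" using bx by simp
      show "compose X a b ((inv_into X b \<circ> inv_into X a) x) = x"
        using ax bx x bij by (simp add: compose_def bij_betw_inv_into_right)
    qed
    then have "?c (inv_into X (compose X a b)) \<longleftrightarrow> ?c (inv_into X b \<circ> inv_into X a)"
      by (rule uniformly_continuous_covering_cong)
    moreover have "?c (a \<circ> b)"
      by (rule uniformly_continuous_covering_comp[where Y = X and \<E> = \<D>]) (use a b in auto)
    moreover have "?c (inv_into X b \<circ> inv_into X a)"
      by (rule uniformly_continuous_covering_comp[where Y = X and \<E> = \<D>]) (use a b in auto)
    ultimately have "compose X a b \<in> ?A" using ab by simp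
    then show "a \<otimes>\<^bsub>BijGroup X\<^esub> b \<in> ?A"
      using B by (simp add: BijGroup_def)
  qed
  then show ?thesis unfolding Aut_def by (rule subgroup_imp_group)
qed

definition UC_b :: "'a set \<Rightarrow> 'a set set set \<Rightarrow> ('a \<Rightarrow> real) set" where
  "UC_b X \<D> = {f \<in> extensional X.
     uniformly_continuous_covering X \<D> UNIV metric_covering_uniformity f \<and> bounded (f ` X)}"

definition mean :: "'a set \<Rightarrow> 'a set set set \<Rightarrow> (('a \<Rightarrow> real) \<Rightarrow> real) \<Rightarrow> bool" where
  "mean X \<D> \<nu> \<longleftrightarrow>
     (\<forall>f\<in>UC_b X \<D>. \<forall>h\<in>UC_b X \<D>. \<nu> (\<lambda>x\<in>X. f x + h x) = \<nu> f + \<nu> h) \<and>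
     (\<forall>c. \<forall>f\<in>UC_b X \<D>. \<nu> (\<lambda>x\<in>X. c * f x) = c * \<nu> f) \<and>
     (\<forall>f\<in>UC_b X \<D>. (INF x\<in>X. f x) \<le> \<nu> f \<and> \<nu> f \<le> (SUP x\<in>X. f x))"

definition amenable :: "'a set \<Rightarrow> 'a set set set \<Rightarrow> ('a \<Rightarrow> 'a) set \<Rightarrow> bool" where
  "amenable X \<D> G \<longleftrightarrow>
     (\<exists>\<nu>. mean X \<D> \<nu> \<and> (\<forall>f\<in>UC_b X \<D>. \<forall>g\<in>G. \<nu> (compose X f g) = \<nu> f))"

text \<open>Intended for finite \<open>E\<close>, where the maximum is over a finite set
  containing \<open>0\<close> (take \<open>D = {}\<close>).\<close>

definition matching_number :: "'a set \<Rightarrow> 'a set \<Rightarrow> 'a set set \<Rightarrow> nat" where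
  "matching_number E F \<U> =
     Max {card D |D \<phi>. D \<subseteq> E \<and> inj_on \<phi> D \<and> \<phi> \<in> D \<rightarrow> F \<and>
                        (\<forall>x\<in>D. \<exists>U\<in>\<U>. {x, \<phi> x} \<subseteq> U)}"

end

theory Submission
  imports Defs
begin

text \<open>Both directions pass through an intermediate condition: for finitely many maps \<open>g\<close>, finitely many
  \<open>f\<close> in \<open>UC_b X \<D>\<close> and \<open>e > 0\<close> there is a finite non-empty \<open>F \<subseteq> X\<close> for which the sums of \<open>f\<close> over
  \<open>F\<close> and over \<open>g ` F\<close> differ by at most \<open>e * card F\<close>.

  An invariant mean yields such sets for functions with values between zero and one
  (\<open>invariant_mean_imp_almost_invariant_sets\<close>), which is the case used for matchings. It vanishes on
  every linear combination \<open>k\<close> of the differences \<open>f \<circ> g - f\<close>, so \<open>k\<close> takes values below one on a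
  non-empty open set, which is infinite because the space is perfect and Hausdorff. One can
  therefore keep adding new points \<open>x\<close> at which the vector \<open>(f (g x) - f x)\<close>, indexed by the pairs
  \<open>(f, g)\<close>, has inner product below one with the sum of the vectors at the points already chosen. The
  squared length of the sum then grows only linearly, so its length is small compared with the number
  of points (\<open>exists_finite_set_small_sums\<close>).

  A set that is almost invariant for suitable functions has large matching numbers
  (\<open>almost_invariant_imp_matching\<close>): by the deficiency version of Hall's theorem
  (\<open>hall_deficiency\<close>) it suffices to bound \<open>card S\<close>, for \<open>S \<subseteq> F\<close>, by the number of points of \<open>g ` F\<close>
  in the star of \<open>S\<close>, up to a multiple of \<open>card F\<close>. A uniformly continuous function that is one on
  \<open>S\<close> and zero off that star provides this bound. Such functions come from \<open>uniform_urysohn\<close>, and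
  finitely many of them serve all \<open>S\<close> because the covering is finite.

  Conversely, a large matching for a covering whose members have small oscillation forces the sums
  over \<open>F\<close> and \<open>g ` F\<close> to be close (\<open>matching_imp_almost_invariant\<close>); a bounded uniformly continuous
  function has small oscillation on the members of some finite uniform covering. By compactness the
  averages over almost invariant sets accumulate at an invariant mean
  (\<open>almost_invariant_sets_imp_amenable\<close>).\<close>

section \<open>Uniform coverings and uniformly continuous functions\<close>

lemma uniformity_covering:
  assumes "covering_uniformity X \<D>" "\<U> \<in> \<D>"
  shows "covering X \<U>"
  using assms by (simp add: covering_uniformity_def)

lemma uniformity_coarser:
  assumes "covering_uniformity X \<D>" "\<U> \<in> \<D>" "covering X \<V>" "\<V> \<preceq>\<^sub>c \<U>"
  shows "\<V> \<in> \<D>"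
  using assms unfolding covering_uniformity_def by blast

lemma refined_by_star_family: "\<U> \<preceq>\<^sub>c star_family \<W> \<Longrightarrow> \<U> \<preceq>\<^sub>c \<W>"
  unfolding refined_by_def
proof
  fix w assume sf: "\<forall>V\<in>star_family \<W>. \<exists>U\<in>\<U>. V \<subseteq> U" and w: "w \<in> \<W>"
  then obtain u where "u \<in> \<U>" "star w \<W> \<subseteq> u" unfolding star_family_def by auto
  moreover have "w \<subseteq> star w \<W>" using w unfolding star_def by auto
  ultimately show "\<exists>u\<in>\<U>. w \<subseteq> u" by auto
qed

lemma uniformity_star_refinement:
  assumes "covering_uniformity X \<D>" "\<U> \<in> \<D>"
  obtains \<W> where "\<W> \<in> \<D>" "\<U> \<preceq>\<^sub>c star_family \<W>"
  using assms unfolding covering_uniformity_def by blast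

lemma uniformity_common_refinement:
  assumes "covering_uniformity X \<D>" "\<U> \<in> \<D>" "\<V> \<in> \<D>"
  obtains \<W> where "\<W> \<in> \<D>" "\<U> \<preceq>\<^sub>c \<W>" "\<V> \<preceq>\<^sub>c \<W>"
proof -
  obtain \<W> where W: "\<W> \<in> \<D>" "\<U> \<preceq>\<^sub>c star_family \<W>" "\<V> \<preceq>\<^sub>c star_family \<W>"
    using assms unfolding covering_uniformity_def by meson
  show thesis
    by (rule that[OF W(1) W(2,3)[THEN refined_by_star_family]])
qed

lemma uniformity_meet:
  assumes D: "covering_uniformity X \<D>" and "\<U> \<in> \<D>" "\<V> \<in> \<D>"
  shows "(\<lambda>(A, B). A \<inter> B) ` (\<U> \<times> \<V>) \<in> \<D>"
proof -
  obtain \<W> where W: "\<W> \<in> \<D>" "\<U> \<preceq>\<^sub>c \<W>" "\<V> \<preceq>\<^sub>c \<W>"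
    using uniformity_common_refinement[OF assms] .
  show ?thesis
  proof (rule uniformity_coarser[OF D W(1)])
    have c: "covering X \<U>" "covering X \<V>" using assms uniformity_covering by auto
    have "(\<Union>(A, B)\<in>\<U> \<times> \<V>. A \<inter> B) = \<Union>\<U> \<inter> \<Union>\<V>" by blast
    moreover have "A \<inter> B \<subseteq> X" if "A \<in> \<U>" for A B
      using c(1) that unfolding covering_def by blast
    ultimately show "covering X ((\<lambda>(A, B). A \<inter> B) ` (\<U> \<times> \<V>))"
      using c unfolding covering_def by auto
    show "(\<lambda>(A, B). A \<inter> B) ` (\<U> \<times> \<V>) \<preceq>\<^sub>c \<W>"
      unfolding refined_by_def
    proof
      fix w assume "w \<in> \<W>"
      then obtain A B where "A \<in> \<U>" "w \<subseteq> A" "B \<in> \<V>" "w \<subseteq> B"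
        using W unfolding refined_by_def by meson
      then show "\<exists>U\<in>(\<lambda>(A, B). A \<inter> B) ` (\<U> \<times> \<V>). w \<subseteq> U"
        by (intro bexI[of _ "A \<inter> B"]) auto
    qed
  qed
qed

lemma uniformity_trivial_covering:
  assumes D: "covering_uniformity X \<D>"
  shows "{X} \<in> \<D>"
proof -
  obtain \<U> where U: "\<U> \<in> \<D>" using D by (auto simp: covering_uniformity_def)
  then have "covering X \<U>" using D uniformity_covering by blast
  then show ?thesis
    by (intro uniformity_coarser[OF D U]) (auto simp: covering_def refined_by_def)
qed

text \<open>A set \<open>w\<close> of small oscillation lies in the preimage of a ball around any of its values;
  conversely, the preimages of the balls of a fixed radius under a uniformly continuous map form a
  uniform covering.\<close>

lemma uniformly_continuous_covering_metric_iff: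
  fixes f :: "'a \<Rightarrow> 'b::metric_space"
  assumes D: "covering_uniformity X \<D>"
  shows "uniformly_continuous_covering X \<D> UNIV metric_covering_uniformity f \<longleftrightarrow>
    (\<forall>e>0. \<exists>\<W>\<in>\<D>. \<forall>w\<in>\<W>. \<forall>x\<in>w. \<forall>y\<in>w. dist (f x) (f y) < e)"
proof
  assume L: "uniformly_continuous_covering X \<D> UNIV metric_covering_uniformity f"
  show "\<forall>e>0. \<exists>\<W>\<in>\<D>. \<forall>w\<in>\<W>. \<forall>x\<in>w. \<forall>y\<in>w. dist (f x) (f y) < e"
  proof (intro allI impI)
    fix e :: real assume e: "e > 0"
    let ?\<V> = "range (\<lambda>z::'b. ball z (e/2))"
    have "?\<V> \<in> metric_covering_uniformity"
      unfolding metric_covering_uniformity_def covering_def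
      using e by (auto intro!: exI[of _ "e/2"] UN_I centre_in_ball[THEN iffD2])
    then have "(\<lambda>V. f -` V \<inter> X) ` ?\<V> \<in> \<D>"
      using L by (simp add: uniformly_continuous_covering_def)
    moreover have "dist (f x) (f y) < e" if "f x \<in> ball z (e/2)" "f y \<in> ball z (e/2)" for x y z
      using that by (metis dist_commute dist_triangle_half_r mem_ball)
    ultimately show "\<exists>\<W>\<in>\<D>. \<forall>w\<in>\<W>. \<forall>x\<in>w. \<forall>y\<in>w. dist (f x) (f y) < e"
      by (intro bexI[of _ "(\<lambda>V. f -` V \<inter> X) ` ?\<V>"]) auto
  qed
next
  assume R: "\<forall>e>0. \<exists>\<W>\<in>\<D>. \<forall>w\<in>\<W>. \<forall>x\<in>w. \<forall>y\<in>w. dist (f x) (f y) < e"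
  show "uniformly_continuous_covering X \<D> UNIV metric_covering_uniformity f"
    unfolding uniformly_continuous_covering_def
  proof (intro conjI ballI)
    fix \<V> :: "'b set set" assume "\<V> \<in> metric_covering_uniformity"
    then obtain e where V: "covering UNIV \<V>" and e: "e > 0" "\<And>x. \<exists>U\<in>\<V>. ball x e \<subseteq> U"
      unfolding metric_covering_uniformity_def by auto
    obtain \<W> where W: "\<W> \<in> \<D>" "\<forall>w\<in>\<W>. \<forall>x\<in>w. \<forall>y\<in>w. dist (f x) (f y) < e"
      using R e(1) by meson
    show "(\<lambda>V. f -` V \<inter> X) ` \<V> \<in> \<D>"
    proof (rule uniformity_coarser[OF D W(1)])
      have "(\<Union>V\<in>\<V>. f -` V \<inter> X) = f -` \<Union>\<V> \<inter> X" by auto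
      then show "covering X ((\<lambda>V. f -` V \<inter> X) ` \<V>)" using V by (auto simp: covering_def)
      show "(\<lambda>V. f -` V \<inter> X) ` \<V> \<preceq>\<^sub>c \<W>"
        unfolding refined_by_def
      proof
        fix w assume w: "w \<in> \<W>"
        then have wX: "w \<subseteq> X" using uniformity_covering[OF D W(1)] by (auto simp: covering_def)
        obtain p where p: "p = f (SOME x. x \<in> w)" by blast
        obtain V where V: "V \<in> \<V>" "ball p e \<subseteq> V" using e(2) by blast
        have "w \<subseteq> f -` V \<inter> X"
        proof
          fix x assume x: "x \<in> w"
          then have "(SOME x. x \<in> w) \<in> w" by (rule someI)
          with x w W(2) have "f x \<in> ball p e" unfolding p by simp
          then show "x \<in> f -` V \<inter> X" using V(2) wX x by auto
        qed
        then show "\<exists>U\<in>(\<lambda>V. f -` V \<inter> X) ` \<V>. w \<subseteq> U" using V(1) by blast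
      qed
    qed
  qed simp
qed

lemma UC_b_iff:
  assumes "covering_uniformity X \<D>"
  shows "f \<in> UC_b X \<D> \<longleftrightarrow> f \<in> extensional X \<and> bounded (f ` X) \<and>
    (\<forall>e>0. \<exists>\<W>\<in>\<D>. \<forall>w\<in>\<W>. \<forall>x\<in>w. \<forall>y\<in>w. \<bar>f x - f y\<bar> < e)"
  unfolding UC_b_def uniformly_continuous_covering_metric_iff[OF assms] dist_real_def by auto

lemma UC_b_const:
  assumes D: "covering_uniformity X \<D>"
  shows "(\<lambda>x\<in>X. c) \<in> UC_b X \<D>"
  unfolding UC_b_iff[OF D]
proof (intro conjI allI impI)
  show "bounded ((\<lambda>x\<in>X. c) ` X)" by (rule bounded_subset[of "{c}"]) auto
  show "\<exists>\<W>\<in>\<D>. \<forall>w\<in>\<W>. \<forall>x\<in>w. \<forall>y\<in>w. \<bar>(\<lambda>x\<in>X. c) x - (\<lambda>x\<in>X. c) y\<bar> < e" if "e > 0" for e :: real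
    using uniformity_trivial_covering[OF D] that by (intro bexI[of _ "{X}"]) auto
qed simp

lemma UC_b_add:
  assumes D: "covering_uniformity X \<D>" and f: "f \<in> UC_b X \<D>" and h: "h \<in> UC_b X \<D>"
  shows "(\<lambda>x\<in>X. f x + h x) \<in> UC_b X \<D>"
  unfolding UC_b_iff[OF D]
proof (intro conjI allI impI)
  have "bounded ((\<lambda>x. f x + h x) ` X)"
    using f h unfolding UC_b_iff[OF D] by (intro bounded_plus_comp) auto
  then show "bounded ((\<lambda>x\<in>X. f x + h x) ` X)" by simp
  fix e :: real assume "e > 0"
  then have e: "e/2 > 0" by simp
  obtain \<U> where U: "\<U> \<in> \<D>" "\<forall>w\<in>\<U>. \<forall>x\<in>w. \<forall>y\<in>w. \<bar>f x - f y\<bar> < e/2"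
    using f e unfolding UC_b_iff[OF D] by meson
  obtain \<V> where V: "\<V> \<in> \<D>" "\<forall>w\<in>\<V>. \<forall>x\<in>w. \<forall>y\<in>w. \<bar>h x - h y\<bar> < e/2"
    using h e unfolding UC_b_iff[OF D] by meson
  have "\<bar>(\<lambda>x\<in>X. f x + h x) x - (\<lambda>x\<in>X. f x + h x) y\<bar> < e"
    if AB: "A \<in> \<U>" "B \<in> \<V>" and xy: "x \<in> A \<inter> B" "y \<in> A \<inter> B" for A B x y
  proof -
    have "x \<in> X" "y \<in> X"
      using AB xy uniformity_covering[OF D U(1)] by (auto simp: covering_def)
    moreover have "\<bar>f x - f y\<bar> < e/2" "\<bar>h x - h y\<bar> < e/2" using U(2) V(2) AB xy by auto
    then have "\<bar>(f x + h x) - (f y + h y)\<bar> < e" by linarith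
    ultimately show ?thesis by simp
  qed
  then show "\<exists>\<W>\<in>\<D>. \<forall>w\<in>\<W>. \<forall>x\<in>w. \<forall>y\<in>w. \<bar>(\<lambda>x\<in>X. f x + h x) x - (\<lambda>x\<in>X. f x + h x) y\<bar> < e"
    by (intro bexI[OF _ uniformity_meet[OF D U(1) V(1)]]) blast
qed simp

lemma UC_b_scale:
  assumes D: "covering_uniformity X \<D>" and f: "f \<in> UC_b X \<D>"
  shows "(\<lambda>x\<in>X. c * f x) \<in> UC_b X \<D>"
  unfolding UC_b_iff[OF D]
proof (intro conjI allI impI)
  have "bounded ((\<lambda>x. c *\<^sub>R x) ` f ` X)"
    using f unfolding UC_b_iff[OF D] by (intro bounded_scaling) auto
  then show "bounded ((\<lambda>x\<in>X. c * f x) ` X)" by (simp add: image_image)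
  fix e :: real assume e: "e > 0"
  then have "e / (\<bar>c\<bar> + 1) > 0" by simp
  then obtain \<U> where U: "\<U> \<in> \<D>" "\<forall>w\<in>\<U>. \<forall>x\<in>w. \<forall>y\<in>w. \<bar>f x - f y\<bar> < e / (\<bar>c\<bar> + 1)"
    using f unfolding UC_b_iff[OF D] by meson
  have "\<bar>(\<lambda>x\<in>X. c * f x) x - (\<lambda>x\<in>X. c * f x) y\<bar> < e"
    if A: "A \<in> \<U>" and xy: "x \<in> A" "y \<in> A" for A x y
  proof -
    have X: "x \<in> X" "y \<in> X"
      using A xy uniformity_covering[OF D U(1)] by (auto simp: covering_def)
    have "\<bar>f x - f y\<bar> * (\<bar>c\<bar> + 1) < e" using U(2) A xy by (simp add: field_simps)
    moreover have "\<bar>c * f x - c * f y\<bar> = \<bar>c\<bar> * \<bar>f x - f y\<bar>"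
      by (simp add: abs_mult flip: right_diff_distrib)
    ultimately show ?thesis using X by (simp add: algebra_simps)
  qed
  then show "\<exists>\<W>\<in>\<D>. \<forall>w\<in>\<W>. \<forall>x\<in>w. \<forall>y\<in>w. \<bar>(\<lambda>x\<in>X. c * f x) x - (\<lambda>x\<in>X. c * f x) y\<bar> < e"
    using U(1) by blast
qed simp

lemma UC_b_compose:
  assumes D: "covering_uniformity X \<D>" and f: "f \<in> UC_b X \<D>"
    and g: "uniformly_continuous_covering X \<D> X \<D> g"
  shows "compose X f g \<in> UC_b X \<D>"
proof -
  have "uniformly_continuous_covering X \<D> UNIV metric_covering_uniformity (f \<circ> g)"
    using uniformly_continuous_covering_comp[OF g] f by (auto simp: UC_b_def)
  then have "uniformly_continuous_covering X \<D> UNIV metric_covering_uniformity (compose X f g)"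
    by (subst uniformly_continuous_covering_cong[where g = "f \<circ> g"]) (auto simp: compose_def)
  moreover have "compose X f g ` X \<subseteq> f ` X"
    using g by (auto simp: compose_def uniformly_continuous_covering_def)
  ultimately show ?thesis
    using f bounded_subset unfolding UC_b_def compose_def by auto
qed

lemma UC_b_sum:
  assumes D: "covering_uniformity X \<D>" and "finite J" and k: "\<And>j. j \<in> J \<Longrightarrow> k j \<in> UC_b X \<D>"
  shows "(\<lambda>x\<in>X. \<Sum>j\<in>J. c j * k j x) \<in> UC_b X \<D>"
  using assms(2,3)
proof (induction J)
  case empty
  show ?case unfolding sum.empty by (rule UC_b_const[OF D])
next
  case (insert j J)
  have "(\<lambda>x\<in>X. (\<lambda>x\<in>X. c j * k j x) x + (\<lambda>x\<in>X. \<Sum>j\<in>J. c j * k j x) x) \<in> UC_b X \<D>"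
    using insert by (intro UC_b_add[OF D] UC_b_scale[OF D]) auto
  also have "(\<lambda>x\<in>X. (\<lambda>x\<in>X. c j * k j x) x + (\<lambda>x\<in>X. \<Sum>j\<in>J. c j * k j x) x)
    = (\<lambda>x\<in>X. \<Sum>j\<in>insert j J. c j * k j x)"
    using insert.hyps by (intro restrict_ext) simp
  finally show ?case .
qed

lemma mean_sum:
  assumes D: "covering_uniformity X \<D>" and \<nu>: "mean X \<D> \<nu>"
    and "finite J" and k: "\<And>j. j \<in> J \<Longrightarrow> k j \<in> UC_b X \<D>"
  shows "\<nu> (\<lambda>x\<in>X. \<Sum>j\<in>J. c j * k j x) = (\<Sum>j\<in>J. c j * \<nu> (k j))"
  using assms(3,4)
proof (induction J)
  case empty
  have "\<nu> (\<lambda>x\<in>X. 0 * (\<lambda>x\<in>X. 0) x) = 0 * \<nu> (\<lambda>x\<in>X. 0)"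
    using \<nu> UC_b_const[OF D] unfolding mean_def by blast
  then show ?case unfolding sum.empty mult_zero_left .
next
  case (insert j J)
  have eq: "(\<lambda>x\<in>X. \<Sum>j\<in>insert j J. c j * k j x)
    = (\<lambda>x\<in>X. (\<lambda>x\<in>X. c j * k j x) x + (\<lambda>x\<in>X. \<Sum>j\<in>J. c j * k j x) x)"
    using insert.hyps by (intro restrict_ext) simp
  have k: "k j \<in> UC_b X \<D>" "\<And>i. i \<in> J \<Longrightarrow> k i \<in> UC_b X \<D>" using insert.prems by auto
  have "(\<lambda>x\<in>X. c j * k j x) \<in> UC_b X \<D>" by (rule UC_b_scale[OF D k(1)])
  moreover have "(\<lambda>x\<in>X. \<Sum>j\<in>J. c j * k j x) \<in> UC_b X \<D>"
    by (rule UC_b_sum[OF D insert.hyps(1) k(2)])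
  ultimately have "\<nu> (\<lambda>x\<in>X. \<Sum>j\<in>insert j J. c j * k j x)
      = \<nu> (\<lambda>x\<in>X. c j * k j x) + \<nu> (\<lambda>x\<in>X. \<Sum>j\<in>J. c j * k j x)"
    using \<nu> unfolding mean_def eq by blast
  also have "\<nu> (\<lambda>x\<in>X. c j * k j x) = c j * \<nu> (k j)"
    using \<nu> k(1) unfolding mean_def by blast
  also have "\<nu> (\<lambda>x\<in>X. \<Sum>j\<in>J. c j * k j x) = (\<Sum>j\<in>J. c j * \<nu> (k j))"
    by (rule insert.IH[OF k(2)])
  finally show ?case unfolding sum.insert[OF insert.hyps] .
qed

lemma uniform_open_UC_b_less:
  assumes D: "covering_uniformity X \<D>" and f: "f \<in> UC_b X \<D>"
  shows "uniform_open X \<D> {x \<in> X. f x < a}"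
  unfolding uniform_open_def
proof (intro conjI ballI)
  fix x assume "x \<in> {x \<in> X. f x < a}"
  then have x: "x \<in> X" "a - f x > 0" by auto
  then obtain \<W> where W: "\<W> \<in> \<D>" "\<forall>w\<in>\<W>. \<forall>y\<in>w. \<forall>z\<in>w. \<bar>f y - f z\<bar> < a - f x"
    using f unfolding UC_b_iff[OF D] by meson
  have "y \<in> {x \<in> X. f x < a}" if "y \<in> star {x} \<W>" for y
  proof -
    obtain w where w: "w \<in> \<W>" "x \<in> w" "y \<in> w" using \<open>y \<in> star {x} \<W>\<close> unfolding star_def by auto
    then have "\<bar>f x - f y\<bar> < a - f x" using W(2) by blast
    moreover have "y \<in> X" using w uniformity_covering[OF D W(1)] by (auto simp: covering_def)
    ultimately show ?thesis by simp
  qed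
  then show "\<exists>\<U>\<in>\<D>. star {x} \<U> \<subseteq> {x \<in> X. f x < a}" using W(1) by blast
qed simp

lemma perfect_Hausdorff_openin_infinite:
  assumes "Hausdorff_space T" "perfect_space T" "openin T S" "S \<noteq> {}"
  shows "infinite S"
proof
  assume fin: "finite S"
  obtain x where x: "x \<in> S" using assms(4) by blast
  have top: "S \<subseteq> topspace T" using assms(3) openin_subset by blast
  have "closedin T (S - {x})"
    using assms(1) fin top by (intro closedin_Hausdorff_finite) auto
  then have "openin T (S - (S - {x}))" using assms(3) by (rule openin_diff[rotated])
  moreover have "S - (S - {x}) = {x}" using x by blast
  ultimately show False using assms(2) x top unfolding perfect_space_def by auto
qed

text \<open>A bounded set of reals is totally bounded, so finitely many of the preimages of small balls
  already cover \<open>X\<close>.\<close>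

lemma finite_uniform_covering_small_oscillation_single:
  assumes D: "covering_uniformity X \<D>" and f: "f \<in> UC_b X \<D>" and e: "e > 0"
  shows "\<exists>\<U>\<in>\<D>. finite \<U> \<and> (\<forall>u\<in>\<U>. \<forall>x\<in>u. \<forall>y\<in>u. \<bar>f x - f y\<bar> < e)"
proof -
  have "compact (closure (f ` X))" using f unfolding UC_b_iff[OF D] by simp
  moreover have "e/4 > 0" using e by simp
  ultimately obtain T where T: "finite T" "closure (f ` X) \<subseteq> (\<Union>t\<in>T. ball t (e/4))"
    unfolding compact_eq_totally_bounded by meson
  obtain \<W> where W: "\<W> \<in> \<D>" "\<forall>w\<in>\<W>. \<forall>x\<in>w. \<forall>y\<in>w. \<bar>f x - f y\<bar> < e/4"
    using f \<open>e/4 > 0\<close> unfolding UC_b_iff[OF D] by meson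
  have cov: "\<exists>t\<in>T. \<bar>t - f x\<bar> < e/4" if "x \<in> X" for x
    using T(2) closure_subset[of "f ` X"] that by (force simp: dist_real_def)
  \<comment> \<open>the empty set is added only to cover an empty member of \<open>\<W>\<close> when \<open>T\<close> is empty\<close>
  define \<U> where "\<U> = insert {} ((\<lambda>t. {x \<in> X. \<bar>t - f x\<bar> < e/2}) ` T)"
  have "\<U> \<in> \<D>"
  proof (rule uniformity_coarser[OF D W(1)])
    have "x \<in> \<Union>\<U>" if x: "x \<in> X" for x
    proof -
      obtain t where t: "t \<in> T" "\<bar>t - f x\<bar> < e/4" using cov[OF x] ..
      then have "\<bar>t - f x\<bar> < e/2" using e by linarith
      with t(1) x show ?thesis unfolding \<U>_def by auto
    qed
    then show "covering X \<U>" unfolding covering_def \<U>_def by auto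
    show "\<U> \<preceq>\<^sub>c \<W>"
      unfolding refined_by_def
    proof
      fix w assume w: "w \<in> \<W>"
      show "\<exists>u\<in>\<U>. w \<subseteq> u"
      proof (cases "w = {}")
        case False
        then obtain x where x: "x \<in> w" by blast
        have wX: "w \<subseteq> X" using w uniformity_covering[OF D W(1)] by (auto simp: covering_def)
        then obtain t where t: "t \<in> T" "\<bar>t - f x\<bar> < e/4" using cov x by blast
        have "\<bar>t - f y\<bar> < e/2" if "y \<in> w" for y
        proof -
          have "\<bar>f x - f y\<bar> < e/4" using W(2) w x that by blast
          then show ?thesis using t(2) by arith
        qed
        then have "w \<subseteq> {x \<in> X. \<bar>t - f x\<bar> < e/2}" using wX by auto
        then show ?thesis using t(1) unfolding \<U>_def by auto
      qed (auto simp: \<U>_def)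
    qed
  qed
  moreover have "\<bar>f x - f y\<bar> < e" if "\<bar>t - f x\<bar> < e/2" "\<bar>t - f y\<bar> < e/2" for t x y
    using that by arith
  ultimately show ?thesis
    using T(1) by (intro bexI[of _ \<U>]) (auto simp: \<U>_def)
qed

lemma finite_uniform_covering_small_oscillation:
  assumes D: "covering_uniformity X \<D>" and "finite H" "H \<subseteq> UC_b X \<D>" and e: "e > 0"
  shows "\<exists>\<U>\<in>\<D>. finite \<U> \<and> (\<forall>f\<in>H. \<forall>u\<in>\<U>. \<forall>x\<in>u. \<forall>y\<in>u. \<bar>f x - f y\<bar> < e)"
  using assms(2,3)
proof (induction H)
  case empty
  show ?case using uniformity_trivial_covering[OF D] by (intro bexI[of _ "{X}"]) auto
next
  case (insert f H)
  from insert.prems have H: "H \<subseteq> UC_b X \<D>" and f: "f \<in> UC_b X \<D>" by auto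
  obtain \<U> where U: "\<U> \<in> \<D>" "finite \<U>" "\<forall>f\<in>H. \<forall>u\<in>\<U>. \<forall>x\<in>u. \<forall>y\<in>u. \<bar>f x - f y\<bar> < e"
    using insert.IH[OF H] by (elim bexE conjE)
  obtain \<V> where V: "\<V> \<in> \<D>" "finite \<V>" "\<forall>u\<in>\<V>. \<forall>x\<in>u. \<forall>y\<in>u. \<bar>f x - f y\<bar> < e"
    using finite_uniform_covering_small_oscillation_single[OF D f e] by (elim bexE conjE)
  show ?case
    by (rule bexI[OF _ uniformity_meet[OF D U(1) V(1)]]) (use U V in auto)
qed

section \<open>Uniform separation of a set from the complement of its star\<close>

lemma star_mono: "A \<subseteq> B \<Longrightarrow> star A \<U> \<subseteq> star B \<U>"
  unfolding star_def by auto

lemma star_subset: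
  assumes "covering X \<U>"
  shows "star A \<U> \<subseteq> X"
  using assms unfolding star_def covering_def by auto

lemma subset_star:
  assumes "covering X \<U>" "A \<subseteq> X"
  shows "A \<subseteq> star A \<U>"
proof
  fix x assume x: "x \<in> A"
  then have "x \<in> \<Union>\<U>" using assms unfolding covering_def by auto
  then show "x \<in> star A \<U>" using x unfolding star_def by auto
qed

lemma star_refined_by:
  assumes "\<U> \<preceq>\<^sub>c \<V>"
  shows "star A \<V> \<subseteq> star A \<U>"
proof
  fix x assume "x \<in> star A \<V>"
  then obtain v where v: "v \<in> \<V>" "v \<inter> A \<noteq> {}" "x \<in> v" unfolding star_def by auto
  then obtain u where "u \<in> \<U>" "v \<subseteq> u" using assms unfolding refined_by_def by meson
  then show "x \<in> star A \<U>" using v unfolding star_def by auto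
qed

text \<open>A chain of three members of \<open>\<W>\<close> lies in the star of the middle one.\<close>

lemma star_star_star_subset:
  assumes "\<U> \<preceq>\<^sub>c star_family \<W>"
  shows "star (star (star A \<W>) \<W>) \<W> \<subseteq> star A \<U>"
proof
  fix x assume "x \<in> star (star (star A \<W>) \<W>) \<W>"
  then obtain w3 y where w3: "w3 \<in> \<W>" "x \<in> w3" "y \<in> w3" "y \<in> star (star A \<W>) \<W>"
    unfolding star_def[of "star (star A \<W>) \<W>"] by auto
  from w3(4) obtain w2 z where w2: "w2 \<in> \<W>" "y \<in> w2" "z \<in> w2" "z \<in> star A \<W>"
    unfolding star_def[of "star A \<W>"] by auto
  from w2(4) obtain w1 a where w1: "w1 \<in> \<W>" "z \<in> w1" "a \<in> w1" "a \<in> A"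
    unfolding star_def[of A] by auto
  have "star w2 \<W> \<in> star_family \<W>" using w2(1) unfolding star_family_def by auto
  then obtain u where u: "u \<in> \<U>" "star w2 \<W> \<subseteq> u" using assms unfolding refined_by_def by meson
  have "x \<in> star w2 \<W>" "a \<in> star w2 \<W>" using w1 w2 w3 unfolding star_def by auto
  then have "x \<in> u" "a \<in> u" using u(2) by auto
  then show "x \<in> star A \<U>" using u(1) w1(4) unfolding star_def by auto
qed

text \<open>The points reached from \<open>A\<close> by a chain of steps of the given levels, where a step of level \<open>n\<close>
  stays within a member of \<open>W n\<close> and has length \<open>2\<^sup>-\<^sup>n\<close>.\<close>

definition chain_star :: "(nat \<Rightarrow> 'a set set) \<Rightarrow> 'a set \<Rightarrow> nat list \<Rightarrow> 'a set" where
  "chain_star W A ns = foldl (\<lambda>S n. star S (W n)) A ns"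

definition chain_weight :: "nat list \<Rightarrow> real" where
  "chain_weight ns = (\<Sum>n\<leftarrow>ns. (1/2) ^ n)"

lemma chain_star_append: "chain_star W A (ms @ ns) = chain_star W (chain_star W A ms) ns"
  by (simp add: chain_star_def)

lemma chain_weight_nonneg: "0 \<le> chain_weight ns"
  unfolding chain_weight_def by (rule sum_list_nonneg) auto

text \<open>The list is cut at the entry with which the partial sums first reach \<open>a\<close>, or at the last entry
  if they stay below \<open>a\<close>.\<close>

lemma split_list_weight:
  fixes a h :: real
  assumes "ns \<noteq> []" "0 < a" "0 < h" "chain_weight ns < a + h"
  shows "\<exists>ps n qs. ns = ps @ n # qs \<and> chain_weight ps < a \<and> chain_weight qs < h"
  using assms
proof (induction ns arbitrary: a)
  case (Cons n ns)
  let ?x = "(1/2::real) ^ n"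
  have w: "chain_weight (n # ns) = ?x + chain_weight ns" by (simp add: chain_weight_def)
  consider "ns = []" | "?x \<ge> a" | "ns \<noteq> []" "?x < a" by linarith
  then show ?case
  proof cases
    case 1
    then show ?thesis using Cons.prems by (intro exI[of _ "[]"] exI[of _ n]) (auto simp: chain_weight_def)
  next
    case 2
    then have "chain_weight ns < h" using Cons.prems w by simp
    then show ?thesis
      using Cons.prems by (intro exI[of _ "[]"] exI[of _ n] exI[of _ ns]) (auto simp: chain_weight_def)
  next
    case 3
    then have "chain_weight ns < (a - ?x) + h" using Cons.prems w by simp
    then obtain ps m qs where "ns = ps @ m # qs" "chain_weight ps < a - ?x" "chain_weight qs < h"
      using Cons.IH[of "a - ?x"] 3 Cons.prems by auto
    then show ?thesis
      by (intro exI[of _ "n # ps"] exI[of _ m] exI[of _ qs]) (auto simp: chain_weight_def)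
  qed
qed simp

text \<open>This is the estimate behind the metrization of uniform spaces with a countable base. A chain
  of weight below \<open>2\<^sup>-\<^sup>m\<close> splits into two pieces of weight below half of that and a single step between
  them; by induction each piece is a step of level \<open>m + 1\<close>, and three such steps fit in one of level
  \<open>m\<close>.\<close>

lemma chain_star_subset:
  assumes cov: "\<And>n. covering X (W n)" and ref: "\<And>n. W n \<preceq>\<^sub>c star_family (W (Suc n))"
    and "A \<subseteq> X" "chain_weight ns < (1/2) ^ m"
  shows "chain_star W A ns \<subseteq> star A (W m)"
  using assms(3,4)
proof (induction "length ns" arbitrary: ns A m rule: less_induct)
  case less
  show ?case
  proof (cases "ns = []")
    case True
    then show ?thesis using subset_star[OF cov less.prems(1)] by (simp add: chain_star_def)
  next
    case False
    have h: "(1/2::real) ^ m = (1/2) ^ Suc m + (1/2) ^ Suc m" by simp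
    obtain ps n qs where ns: "ns = ps @ n # qs"
      and w: "chain_weight ps < (1/2) ^ Suc m" "chain_weight qs < (1/2) ^ Suc m"
      using split_list_weight[OF False, of "(1/2) ^ Suc m" "(1/2) ^ Suc m"] less.prems(2)
      unfolding h by auto
    have "chain_weight ns = chain_weight ps + (1/2) ^ n + chain_weight qs"
      by (simp add: ns chain_weight_def)
    then have "(1/2::real) ^ n < (1/2) ^ m"
      using less.prems(2) chain_weight_nonneg[of ps] chain_weight_nonneg[of qs] by linarith
    then have "Suc m \<le> n" by (simp add: power_strict_decreasing_iff Suc_le_eq)
    have mono: "W j \<preceq>\<^sub>c W n" if "j \<le> n" for j n
      using that
    proof (induction rule: dec_induct)
      case base
      show ?case unfolding refined_by_def by auto
    next
      case (step n)
      show ?case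
        unfolding refined_by_def
      proof
        fix v assume "v \<in> W (Suc n)"
        then obtain u where "u \<in> W n" "v \<subseteq> u"
          using refined_by_star_family[OF ref[of n]] unfolding refined_by_def by meson
        moreover then obtain t where "t \<in> W j" "u \<subseteq> t"
          using step.IH unfolding refined_by_def by meson
        ultimately show "\<exists>U\<in>W j. v \<subseteq> U" by auto
      qed
    qed
    let ?W = "W (Suc m)"
    have 1: "chain_star W A ps \<subseteq> star A ?W"
      using less.hyps[OF _ less.prems(1) w(1)] ns by simp
    let ?S = "star (chain_star W A ps) (W n)"
    have 2: "?S \<subseteq> star (star A ?W) ?W"
      using star_refined_by[OF mono[OF \<open>Suc m \<le> n\<close>]] star_mono[OF 1] by (rule order_trans)
    have "chain_star W A ns = chain_star W ?S qs"
      by (simp add: ns chain_star_append) (simp add: chain_star_def)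
    also have "\<dots> \<subseteq> star ?S ?W"
      using less.hyps[OF _ star_subset[OF cov] w(2)] ns by simp
    also have "\<dots> \<subseteq> star (star (star A ?W) ?W) ?W" by (rule star_mono[OF 2])
    also have "\<dots> \<subseteq> star A (W m)" by (rule star_star_star_subset[OF ref])
    finally show ?thesis .
  qed
qed

text \<open>The function is one minus a truncated distance from \<open>A\<close>, namely the infimum of the weights of
  the chains that lead from \<open>A\<close> to the given point. Extending a chain by one step of level \<open>n\<close> costs
  \<open>2\<^sup>-\<^sup>n\<close>, which makes the distance uniformly continuous; a chain of weight below one cannot leave the
  star of \<open>A\<close>.\<close>

lemma uniform_urysohn:
  assumes D: "covering_uniformity X \<D>" and "\<U> \<in> \<D>" and A: "A \<subseteq> X"
  obtains f where "f \<in> UC_b X \<D>" "\<And>x. x \<in> X \<Longrightarrow> 0 \<le> f x \<and> f x \<le> 1"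
    "\<And>x. x \<in> A \<Longrightarrow> f x = 1" "\<And>x. x \<in> X \<Longrightarrow> x \<notin> star A \<U> \<Longrightarrow> f x = 0"
proof -
  have "\<exists>W. \<forall>n. (W n \<in> \<D> \<and> (n = 0 \<longrightarrow> W n = \<U>)) \<and> W n \<preceq>\<^sub>c star_family (W (Suc n))"
  proof (rule dependent_nat_choice)
    show "\<exists>\<V>. \<V> \<in> \<D> \<and> (0 = (0::nat) \<longrightarrow> \<V> = \<U>)" using assms(2) by auto
    fix \<V> and n :: nat assume "\<V> \<in> \<D> \<and> (n = 0 \<longrightarrow> \<V> = \<U>)"
    then have "\<V> \<in> \<D>" by simp
    then obtain \<W> where "\<W> \<in> \<D>" "\<V> \<preceq>\<^sub>c star_family \<W>"
      by (rule uniformity_star_refinement[OF D])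
    then show "\<exists>\<W>. (\<W> \<in> \<D> \<and> (Suc n = 0 \<longrightarrow> \<W> = \<U>)) \<and> \<V> \<preceq>\<^sub>c star_family \<W>" by auto
  qed
  then obtain W where W': "\<And>n. (W n \<in> \<D> \<and> (n = 0 \<longrightarrow> W n = \<U>)) \<and> W n \<preceq>\<^sub>c star_family (W (Suc n))"
    by (elim exE) (rule, erule spec)
  have W: "\<And>n. W n \<in> \<D>" "W 0 = \<U>" "\<And>n. W n \<preceq>\<^sub>c star_family (W (Suc n))"
    using W' by auto
  have cov: "covering X (W n)" for n using uniformity_covering[OF D W(1)] .
  define K where "K x = insert 1 {chain_weight ns |ns. x \<in> chain_star W A ns}" for x
  define d where "d x = Inf (K x)" for x
  have K_nonneg: "0 \<le> t" if "t \<in> K x" for t x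
    using that chain_weight_nonneg unfolding K_def by auto
  then have bdd: "bdd_below (K x)" for x by (rule bdd_belowI)
  have ne: "K x \<noteq> {}" for x unfolding K_def by simp
  have d_nonneg: "0 \<le> d x" for x unfolding d_def by (rule cInf_greatest[OF ne K_nonneg])
  have d_le: "d x \<le> t" if "t \<in> K x" for t x unfolding d_def by (rule cInf_lower[OF that bdd])
  have d_le1: "d x \<le> 1" for x by (rule d_le) (simp add: K_def)
  have d_step: "d y \<le> d x + (1/2) ^ n" if w: "w \<in> W n" "x \<in> w" "y \<in> w" for w x y n
  proof -
    have "d y - (1/2) ^ n \<le> t" if t: "t \<in> K x" for t
    proof (cases "t = 1")
      case True
      then show ?thesis using d_le1[of y] zero_le_power[of "1/2::real" n] by linarith
    next
      case False
      then obtain ns where ns: "t = chain_weight ns" "x \<in> chain_star W A ns"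
        using t unfolding K_def by auto
      have "y \<in> star (chain_star W A ns) (W n)" using w ns(2) unfolding star_def by auto
      also have "\<dots> = chain_star W A (ns @ [n])"
        by (simp add: chain_star_append) (simp add: chain_star_def)
      finally have "chain_weight (ns @ [n]) \<in> K y" unfolding K_def by auto
      then have "d y \<le> chain_weight (ns @ [n])" by (rule d_le)
      then show ?thesis by (simp add: ns(1) chain_weight_def)
    qed
    then have "d y - (1/2) ^ n \<le> d x" unfolding d_def[of x] by (rule cInf_greatest[OF ne])
    then show ?thesis by simp
  qed
  have d_far: "1 \<le> d x" if x: "x \<notin> star A \<U>" for x
    unfolding d_def
  proof (rule cInf_greatest[OF ne])
    fix t assume t: "t \<in> K x"
    show "1 \<le> t"
    proof (rule ccontr)
      assume "\<not> 1 \<le> t"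
      then obtain ns where ns: "chain_weight ns < (1/2) ^ 0" "x \<in> chain_star W A ns"
        using t unfolding K_def by (auto simp: not_le)
      have "x \<in> star A (W 0)"
        using chain_star_subset[where W = W, OF cov W(3) A ns(1)] ns(2) by (rule subsetD)
      then show False using W(2) x by simp
    qed
  qed
  define f where "f = (\<lambda>x\<in>X. 1 - d x)"
  show thesis
  proof (rule that)
    show "f \<in> UC_b X \<D>"
      unfolding UC_b_iff[OF D]
    proof (intro conjI allI impI)
      show "f \<in> extensional X" unfolding f_def by simp
      show "bounded (f ` X)"
      proof (rule bounded_subset)
        show "f ` X \<subseteq> {0..1}" using d_nonneg d_le1 by (auto simp: f_def)
      qed simp
      fix e :: real assume "e > 0"
      then obtain n where n: "(1/2) ^ n < e" using real_arch_pow_inv[of e "1/2"] by auto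
      have "\<bar>f x - f y\<bar> < e" if w: "w \<in> W n" "x \<in> w" "y \<in> w" for w x y
      proof -
        have "x \<in> X" "y \<in> X" using w cov[of n] unfolding covering_def by auto
        moreover have "d y \<le> d x + (1/2) ^ n" "d x \<le> d y + (1/2) ^ n"
          using d_step w by auto
        then have "\<bar>(1 - d x) - (1 - d y)\<bar> < e" using n by linarith
        ultimately show ?thesis by (simp add: f_def)
      qed
      then show "\<exists>\<W>\<in>\<D>. \<forall>w\<in>\<W>. \<forall>x\<in>w. \<forall>y\<in>w. \<bar>f x - f y\<bar> < e"
        using W(1)[of n] by (intro bexI[of _ "W n"]) auto
    qed
    show "0 \<le> f x \<and> f x \<le> 1" if "x \<in> X" for x
      using that d_nonneg[of x] d_le1[of x] by (simp add: f_def)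
    show "f x = 1" if x: "x \<in> A" for x
    proof -
      have "chain_weight [] \<in> K x" using x unfolding K_def by (auto simp: chain_star_def intro: exI[of _ "[]"])
      then have "d x \<le> 0" using d_le[of "chain_weight []" x] by (simp add: chain_weight_def)
      then show ?thesis using d_nonneg[of x] x A by (auto simp: f_def)
    qed
    show "f x = 0" if "x \<in> X" "x \<notin> star A \<U>" for x
      using d_far[OF that(2)] d_le1[of x] that(1) by (simp add: f_def)
  qed
qed

section \<open>Matchings with a prescribed deficiency\<close>

text \<open>Rado's argument. If some \<open>A i\<close> has two elements \<open>x \<noteq> y\<close>, one of them can be deleted from
  \<open>A i\<close> without destroying the counting condition: two violating index sets \<open>S\<close> and \<open>T\<close>, one for
  each deletion, would contradict the condition for \<open>S \<union> T\<close> and \<open>S \<inter> T - {i}\<close>. When no \<open>A i\<close> has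
  two elements, an injective choice of indices for the points of the union is a matching.\<close>

lemma hall_deficiency:
  fixes A :: "'i \<Rightarrow> 'b set"
  assumes "finite I" "\<And>i. i \<in> I \<Longrightarrow> finite (A i)"
    and "\<And>S. S \<subseteq> I \<Longrightarrow> card S \<le> card (\<Union>(A ` S)) + d"
  shows "\<exists>D \<phi>. D \<subseteq> I \<and> inj_on \<phi> D \<and> (\<forall>i\<in>D. \<phi> i \<in> A i) \<and> card I \<le> card D + d"
  using assms(2,3)
proof (induction "\<Sum>i\<in>I. card (A i)" arbitrary: A rule: less_induct)
  case less
  show ?case
  proof (cases "\<exists>i\<in>I. \<exists>x\<in>A i. \<exists>y\<in>A i. x \<noteq> y")
    case False
    define \<psi> where "\<psi> v = (SOME i. i \<in> I \<and> v \<in> A i)" for v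
    let ?V = "\<Union>(A ` I)"
    have \<psi>: "\<psi> v \<in> I \<and> v \<in> A (\<psi> v)" if v: "v \<in> ?V" for v
    proof -
      obtain i where "i \<in> I \<and> v \<in> A i" using v by auto
      then show ?thesis unfolding \<psi>_def by (rule someI)
    qed
    have inj: "inj_on \<psi> ?V"
    proof (rule inj_onI)
      fix v w assume vw: "v \<in> ?V" "w \<in> ?V" "\<psi> v = \<psi> w"
      with \<psi>[of v] \<psi>[of w] False show "v = w" by metis
    qed
    have "\<psi> ` ?V \<subseteq> I" using \<psi> by auto
    moreover have "inj_on (inv_into ?V \<psi>) (\<psi> ` ?V)" by (rule inj_on_inv_into) simp
    moreover have "\<forall>i\<in>\<psi> ` ?V. inv_into ?V \<psi> i \<in> A i"
      using \<psi> inv_into_f_f[OF inj] by (metis (no_types, lifting) imageE)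
    moreover have "card I \<le> card (\<psi> ` ?V) + d"
      using less.prems(2)[OF order_refl] card_image[OF inj] by simp
    ultimately show ?thesis by (intro exI conjI)
  next
    case True
    then obtain i x y where i: "i \<in> I" and xy: "x \<in> A i" "y \<in> A i" "x \<noteq> y" by auto
    define B where "B z = A(i := A i - {z})" for z
    have step: ?thesis
      if z: "z \<in> A i" and ok: "\<And>S. S \<subseteq> I \<Longrightarrow> card S \<le> card (\<Union>(B z ` S)) + d" for z
    proof -
      have sub: "B z j \<subseteq> A j" for j unfolding B_def by auto
      have "card (B z i) < card (A i)"
        using z less.prems(1)[OF i] unfolding B_def by (simp add: card_Diff1_less del: card_Diff_insert)
      moreover have "card (B z j) \<le> card (A j)" if "j \<in> I" for j
        by (rule card_mono[OF less.prems(1)[OF that] sub])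
      ultimately have "(\<Sum>j\<in>I. card (B z j)) < (\<Sum>j\<in>I. card (A j))"
        using assms(1) i by (intro sum_strict_mono_ex1) auto
      moreover have "finite (B z j)" if "j \<in> I" for j
        using finite_subset[OF sub less.prems(1)[OF that]] .
      ultimately obtain D \<phi> where "D \<subseteq> I" "inj_on \<phi> D" "\<forall>j\<in>D. \<phi> j \<in> B z j" "card I \<le> card D + d"
        using less.hyps[of "B z"] ok by meson
      moreover have "\<forall>j\<in>D. \<phi> j \<in> A j" using calculation(3) sub by auto
      ultimately show ?thesis by (intro exI conjI)
    qed
    show ?thesis
    proof (rule ccontr)
      assume no: "\<not> ?thesis"
      obtain S where S: "S \<subseteq> I" "card (\<Union>(B x ` S)) + d < card S"
        using step[OF xy(1)] no by (meson not_le)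
      obtain T where T: "T \<subseteq> I" "card (\<Union>(B y ` T)) + d < card T"
        using step[OF xy(2)] no by (meson not_le)
      let ?P = "\<Union>(B x ` S)" and ?Q = "\<Union>(B y ` T)"
      have B_other: "B z j = A j" if "j \<noteq> i" for z j using that by (simp add: B_def)
      have hit: "i \<in> R" if R: "R \<subseteq> I" "card (\<Union>(B z ` R)) + d < card R" for R z
      proof (rule ccontr)
        assume "i \<notin> R"
        then have "B z j = A j" if "j \<in> R" for j using that by (intro B_other) auto
        then have "B z ` R = A ` R" by (rule image_cong[OF refl])
        then show False using R less.prems(2)[OF R(1)] by simp
      qed
      have iST: "i \<in> S" "i \<in> T" using hit S T by auto
      have fin: "finite S" "finite T" using S(1) T(1) assms(1) finite_subset by auto
      have finPQ: "finite ?P" "finite ?Q"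
        using fin S(1) T(1) less.prems(1) unfolding B_def by (auto split: if_splits)
      have "?P \<union> ?Q = \<Union>(A ` (S \<union> T))"
      proof
        show "?P \<union> ?Q \<subseteq> \<Union>(A ` (S \<union> T))" unfolding B_def by (auto split: if_splits)
        show "\<Union>(A ` (S \<union> T)) \<subseteq> ?P \<union> ?Q"
        proof
          fix v assume "v \<in> \<Union>(A ` (S \<union> T))"
          then obtain j where j: "j \<in> S \<union> T" "v \<in> A j" by auto
          show "v \<in> ?P \<union> ?Q"
          proof (cases "j = i")
            case True
            with j xy(3) have "v \<in> B x i \<or> v \<in> B y i" by (auto simp: B_def)
            then show ?thesis using iST by auto
          next
            case False
            then have "v \<in> B x j" "v \<in> B y j" using j(2) B_other by auto
            then show ?thesis using j(1) by auto
          qed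
        qed
      qed
      then have 1: "card (S \<union> T) \<le> card (?P \<union> ?Q) + d"
        using less.prems(2)[of "S \<union> T"] S(1) T(1) by simp
      have "\<Union>(A ` (S \<inter> T - {i})) \<subseteq> ?P \<inter> ?Q" using B_other by fastforce
      then have "card (\<Union>(A ` (S \<inter> T - {i}))) \<le> card (?P \<inter> ?Q)"
        using finPQ by (intro card_mono) auto
      moreover have "card (S \<inter> T - {i}) \<le> card (\<Union>(A ` (S \<inter> T - {i}))) + d"
        using S(1) by (intro less.prems(2)) auto
      moreover have "card (S \<inter> T) = Suc (card (S \<inter> T - {i}))"
        using iST fin by (simp add: card_Suc_Diff1 del: card_Diff_insert)
      ultimately have 2: "card (S \<inter> T) \<le> card (?P \<inter> ?Q) + d + 1" by linarith
      show False
        using 1 2 S(2) T(2) card_Un_Int[OF fin] card_Un_Int[OF finPQ] by linarith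
    qed
  qed
qed

lemma finite_matching_cardinalities:
  assumes "finite E"
  shows "finite {card D |D \<phi>. D \<subseteq> E \<and> inj_on \<phi> D \<and> \<phi> \<in> D \<rightarrow> F \<and>
                        (\<forall>x\<in>D. \<exists>U\<in>\<U>. {x, \<phi> x} \<subseteq> U)}"
  by (rule finite_subset[of _ "{..card E}"]) (auto intro: card_mono[OF assms])

lemma matching_number_ge:
  assumes "finite E" "D \<subseteq> E" "inj_on \<phi> D" "\<phi> \<in> D \<rightarrow> F" "\<forall>x\<in>D. \<exists>U\<in>\<U>. {x, \<phi> x} \<subseteq> U"
  shows "card D \<le> matching_number E F \<U>"
  unfolding matching_number_def
  by (rule Max_ge[OF finite_matching_cardinalities[OF assms(1)]]) (use assms in auto)

lemma matching_number_attained: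
  assumes "finite E"
  obtains D \<phi> where "D \<subseteq> E" "inj_on \<phi> D" "\<phi> \<in> D \<rightarrow> F" "\<forall>x\<in>D. \<exists>U\<in>\<U>. {x, \<phi> x} \<subseteq> U"
    "card D = matching_number E F \<U>"
proof -
  let ?M = "{card D |D \<phi>. D \<subseteq> E \<and> inj_on \<phi> D \<and> \<phi> \<in> D \<rightarrow> F \<and>
                        (\<forall>x\<in>D. \<exists>U\<in>\<U>. {x, \<phi> x} \<subseteq> U)}"
  have "card ({}::'a set) \<in> ?M" by (intro CollectI exI[of _ "{}"]) auto
  then have "Max ?M \<in> ?M" by (intro Max_in[OF finite_matching_cardinalities[OF assms]]) auto
  then show thesis unfolding matching_number_def[symmetric] using that by auto
qed

text \<open>A matched pair contributes at most \<open>e\<close>, an unmatched point on either side at most \<open>M\<close>.\<close>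

lemma sum_diff_le_matching_number:
  fixes f :: "'a \<Rightarrow> real"
  assumes fin: "finite F" "finite F'" and card: "card F' = card F"
    and M: "\<And>x. x \<in> F \<union> F' \<Longrightarrow> \<bar>f x\<bar> \<le> M"
    and e: "\<And>u x y. u \<in> \<U> \<Longrightarrow> x \<in> u \<Longrightarrow> y \<in> u \<Longrightarrow> \<bar>f x - f y\<bar> \<le> e"
  shows "\<bar>(\<Sum>x\<in>F. f x) - (\<Sum>x\<in>F'. f x)\<bar>
    \<le> real (matching_number F F' \<U>) * e + 2 * M * (real (card F) - real (matching_number F F' \<U>))"
proof -
  obtain D \<phi> where D: "D \<subseteq> F" "inj_on \<phi> D" "\<phi> \<in> D \<rightarrow> F'" "\<forall>x\<in>D. \<exists>U\<in>\<U>. {x, \<phi> x} \<subseteq> U"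
    and cD: "card D = matching_number F F' \<U>"
    using matching_number_attained[OF fin(1)] .
  have finD: "finite D" using D(1) fin(1) finite_subset by blast
  have \<phi>D: "\<phi> ` D \<subseteq> F'" using D(3) by auto
  have cle: "card D \<le> card F" using D(1) fin(1) card_mono by blast
  have c: "real (card (F - D)) = real (card F) - real (card D)"
    "real (card (F' - \<phi> ` D)) = real (card F) - real (card D)"
    using card_Diff_subset[OF finD D(1)] card_Diff_subset[OF finite_imageI[OF finD] \<phi>D]
      card_image[OF D(2)] cle card by (auto simp: of_nat_diff)
  have split: "(\<Sum>x\<in>F. f x) - (\<Sum>x\<in>F'. f x)
    = (\<Sum>x\<in>D. f x - f (\<phi> x)) + (\<Sum>x\<in>F - D. f x) - (\<Sum>x\<in>F' - \<phi> ` D. f x)"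
    using sum.subset_diff[OF D(1) fin(1), of f] sum.subset_diff[OF \<phi>D fin(2), of f]
      sum.reindex[OF D(2), of f] by (simp add: sum_subtractf)
  have "\<bar>\<Sum>x\<in>D. f x - f (\<phi> x)\<bar> \<le> (\<Sum>x\<in>D. e)"
  proof (intro order_trans[OF sum_abs] sum_mono)
    fix x assume "x \<in> D"
    then obtain U where "U \<in> \<U>" "x \<in> U" "\<phi> x \<in> U" using D(4) by auto
    then show "\<bar>f x - f (\<phi> x)\<bar> \<le> e" by (rule e)
  qed
  moreover have "\<bar>\<Sum>x\<in>F - D. f x\<bar> \<le> (\<Sum>x\<in>F - D. M)"
    using M by (intro order_trans[OF sum_abs] sum_mono) auto
  moreover have "\<bar>\<Sum>x\<in>F' - \<phi> ` D. f x\<bar> \<le> (\<Sum>x\<in>F' - \<phi> ` D. M)"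
    using M by (intro order_trans[OF sum_abs] sum_mono) auto
  moreover have "\<bar>a + b - d\<bar> \<le> \<bar>a\<bar> + \<bar>b\<bar> + \<bar>d\<bar>" for a b d :: real by arith
  ultimately show ?thesis
    unfolding split cD[symmetric] using c by (simp add: algebra_simps)
qed

section \<open>Finite sets with small sums\<close>

text \<open>Points are added one at a time. If \<open>c j\<close> is the current value of the sum of \<open>k j\<close>, adding \<open>x\<close>
  changes the sum of squares by \<open>2 * (\<Sum>j. c j * k j x) + (\<Sum>j. (k j x)\<^sup>2)\<close>, and the hypothesis
  provides a new point for which this is bounded. The squared norm therefore grows linearly in the
  number of points, and the norm of the average tends to zero.\<close>

lemma exists_finite_set_small_sums:
  fixes k :: "'j \<Rightarrow> 'a \<Rightarrow> real"
  assumes bound: "\<And>j x. j \<in> J \<Longrightarrow> x \<in> X \<Longrightarrow> \<bar>k j x\<bar> \<le> 1"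
    and inf: "\<And>c. infinite {x \<in> X. (\<Sum>j\<in>J. c j * k j x) < 1}"
  shows "\<exists>F\<subseteq>X. finite F \<and> card F = n \<and>
    (\<Sum>j\<in>J. (\<Sum>x\<in>F. k j x)\<^sup>2) \<le> real n * (real (card J) + 2)"
proof (induction n)
  case 0
  show ?case by (intro exI[of _ "{}"]) auto
next
  case (Suc n)
  then obtain F where F: "F \<subseteq> X" "finite F" "card F = n"
    "(\<Sum>j\<in>J. (\<Sum>x\<in>F. k j x)\<^sup>2) \<le> real n * (real (card J) + 2)" by auto
  define c where "c j = (\<Sum>x\<in>F. k j x)" for j
  have "infinite ({x \<in> X. (\<Sum>j\<in>J. c j * k j x) < 1} - F)"
    using inf F(2) by (rule Diff_infinite_finite[rotated])
  from infinite_imp_nonempty[OF this]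
  obtain x where x: "x \<in> X" "(\<Sum>j\<in>J. c j * k j x) < 1" "x \<notin> F" by auto
  have "(\<Sum>j\<in>J. (\<Sum>x\<in>insert x F. k j x)\<^sup>2) = (\<Sum>j\<in>J. (c j)\<^sup>2 + 2 * (c j * k j x) + (k j x)\<^sup>2)"
    using x(3) F(2) by (simp add: c_def power2_eq_square algebra_simps)
  also have "\<dots> = (\<Sum>j\<in>J. (c j)\<^sup>2) + 2 * (\<Sum>j\<in>J. c j * k j x) + (\<Sum>j\<in>J. (k j x)\<^sup>2)"
    by (simp add: sum.distrib sum_distrib_left)
  also have "(\<Sum>j\<in>J. (k j x)\<^sup>2) \<le> (\<Sum>j\<in>J. 1)"
    using bound x(1) by (intro sum_mono) (simp add: abs_square_le_1)
  finally have "(\<Sum>j\<in>J. (\<Sum>x\<in>insert x F. k j x)\<^sup>2) \<le> real (Suc n) * (real (card J) + 2)"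
    using x(2) F(4) unfolding c_def[symmetric] by (simp add: algebra_simps)
  then show ?case using F x by (intro exI[of _ "insert x F"]) auto
qed

section \<open>Amenability and almost invariant finite sets\<close>

lemma mean_eq_0_imp_less:
  assumes D: "covering_uniformity X \<D>" and X: "X \<noteq> {}" and \<nu>: "mean X \<D> \<nu>"
    and f: "f \<in> UC_b X \<D>" and "\<nu> f = 0" "0 < a"
  shows "\<exists>x\<in>X. f x < a"
proof (rule ccontr)
  assume "\<not> ?thesis"
  then have "a \<le> (INF x\<in>X. f x)" using X by (intro cINF_greatest) (auto simp: not_less)
  moreover have "(INF x\<in>X. f x) \<le> \<nu> f" using \<nu> f unfolding mean_def by blast
  ultimately show False using assms(5,6) by simp
qed

text \<open>Since \<open>\<nu>\<close> vanishes on every linear combination of the differences \<open>f \<circ> g - f\<close>, each such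
  combination is below one on a non-empty open set, and such sets are infinite in a perfect
  Hausdorff space. This feeds the greedy construction.\<close>

lemma invariant_mean_imp_almost_invariant_sets:
  assumes D: "covering_uniformity X \<D>" and X: "X \<noteq> {}"
    and T: "Hausdorff_space (uniform_topology X \<D>)" "perfect_space (uniform_topology X \<D>)"
    and \<nu>: "mean X \<D> \<nu>" and inv: "\<And>f g. f \<in> H \<Longrightarrow> g \<in> E \<Longrightarrow> \<nu> (compose X f g) = \<nu> f"
    and E: "finite E" "\<And>g. g \<in> E \<Longrightarrow> uniformly_continuous_covering X \<D> X \<D> g"
    and H: "finite H" "H \<subseteq> UC_b X \<D>" "\<And>f x. f \<in> H \<Longrightarrow> x \<in> X \<Longrightarrow> 0 \<le> f x \<and> f x \<le> 1"
    and e: "0 < e"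
  shows "\<exists>F. finite F \<and> F \<noteq> {} \<and> F \<subseteq> X \<and>
    (\<forall>g\<in>E. \<forall>f\<in>H. \<bar>(\<Sum>x\<in>F. f (g x)) - (\<Sum>x\<in>F. f x)\<bar> \<le> e * real (card F))"
proof -
  define J where "J = H \<times> E"
  define k where "k = (\<lambda>(f :: 'a \<Rightarrow> real, g). \<lambda>x\<in>X. compose X f g x + (\<lambda>x\<in>X. (-1) * f x) x)"
  have finJ: "finite J" using E H by (simp add: J_def)
  have k_apply: "k (f, g) x = f (g x) - f x" if "x \<in> X" for f g x
    using that by (simp add: k_def compose_def)
  have k: "k j \<in> UC_b X \<D> \<and> \<nu> (k j) = 0" if j: "j \<in> J" for j
  proof -
    obtain f g where fg: "j = (f, g)" "f \<in> H" "g \<in> E" using j unfolding J_def by auto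
    have f: "f \<in> UC_b X \<D>" using fg H by auto
    have c: "compose X f g \<in> UC_b X \<D>" using UC_b_compose[OF D f E(2)[OF fg(3)]] .
    have m: "(\<lambda>x\<in>X. (-1) * f x) \<in> UC_b X \<D>" by (rule UC_b_scale[OF D f])
    have "\<nu> (\<lambda>x\<in>X. (-1) * f x) = (-1) * \<nu> f" using \<nu> f unfolding mean_def by blast
    moreover have "\<nu> (\<lambda>x\<in>X. compose X f g x + (\<lambda>x\<in>X. (-1) * f x) x)
        = \<nu> (compose X f g) + \<nu> (\<lambda>x\<in>X. (-1) * f x)"
      using \<nu> c m unfolding mean_def by blast
    ultimately have "\<nu> (k j) = 0" using inv[OF fg(2,3)] unfolding k_def fg(1) prod.case by linarith
    moreover have "k j \<in> UC_b X \<D>" unfolding k_def fg(1) prod.case by (rule UC_b_add[OF D c m])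
    ultimately show ?thesis by simp
  qed
  \<comment> \<open>large enough for \<open>n * (card J + 2) \<le> (e * n)\<^sup>2\<close>; the successor keeps \<open>F\<close> non-empty\<close>
  define n where "n = Suc (nat \<lceil>(real (card J) + 2) / e\<^sup>2\<rceil>)"
  obtain F where F: "F \<subseteq> X" "finite F" "card F = n"
    "(\<Sum>j\<in>J. (\<Sum>x\<in>F. k j x)\<^sup>2) \<le> real n * (real (card J) + 2)"
  proof -
    have "\<exists>F\<subseteq>X. finite F \<and> card F = n \<and>
        (\<Sum>j\<in>J. (\<Sum>x\<in>F. k j x)\<^sup>2) \<le> real n * (real (card J) + 2)"
    proof (rule exists_finite_set_small_sums)
      fix j x assume j: "j \<in> J" and x: "x \<in> X"
      obtain f g where fg: "j = (f, g)" "f \<in> H" "g \<in> E" using j unfolding J_def by auto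
      have "g x \<in> X" using E(2)[OF fg(3)] x by (auto simp: uniformly_continuous_covering_def)
      then show "\<bar>k j x\<bar> \<le> 1"
        using H(3)[OF fg(2), of x] H(3)[OF fg(2), of "g x"] x
        by (simp add: fg(1) k_apply abs_le_iff)
    next
      fix c :: "('a \<Rightarrow> real) \<times> ('a \<Rightarrow> 'a) \<Rightarrow> real"
      let ?K = "\<lambda>x\<in>X. \<Sum>j\<in>J. c j * k j x"
      have K: "?K \<in> UC_b X \<D>" using k by (intro UC_b_sum[OF D finJ]) auto
      have "\<nu> ?K = (\<Sum>j\<in>J. c j * \<nu> (k j))" using k by (intro mean_sum[OF D \<nu> finJ]) auto
      also have "\<dots> = 0" using k by simp
      finally have "\<exists>x\<in>X. ?K x < 1" by (intro mean_eq_0_imp_less[OF D X \<nu> K]) auto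
      then have "{x \<in> X. ?K x < 1} \<noteq> {}" by auto
      moreover have "openin (uniform_topology X \<D>) {x \<in> X. ?K x < 1}"
        unfolding openin_uniform_topology[OF D] by (rule uniform_open_UC_b_less[OF D K])
      ultimately have "infinite {x \<in> X. ?K x < 1}"
        by (intro perfect_Hausdorff_openin_infinite[OF T])
      moreover have "{x \<in> X. ?K x < 1} = {x \<in> X. (\<Sum>j\<in>J. c j * k j x) < 1}" by auto
      ultimately show "infinite {x \<in> X. (\<Sum>j\<in>J. c j * k j x) < 1}" by simp
    qed
    then show thesis using that by auto
  qed
  have "(real (card J) + 2) / e\<^sup>2 \<le> real n" unfolding n_def by linarith
  then have "real (card J) + 2 \<le> e\<^sup>2 * real n" using e by (simp add: field_simps)
  then have n: "real n * (real (card J) + 2) \<le> (e * real n)\<^sup>2"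
    using mult_left_mono[of "real (card J) + 2" "e\<^sup>2 * real n" "real n"]
    by (simp add: power2_eq_square algebra_simps)
  have "\<bar>(\<Sum>x\<in>F. f (g x)) - (\<Sum>x\<in>F. f x)\<bar> \<le> e * real (card F)" if fg: "f \<in> H" "g \<in> E" for f g
  proof -
    have "(\<Sum>x\<in>F. k (f, g) x)\<^sup>2 \<le> (\<Sum>j\<in>J. (\<Sum>x\<in>F. k j x)\<^sup>2)"
      using fg finJ by (intro member_le_sum) (auto simp: J_def)
    also have "\<dots> \<le> (e * real n)\<^sup>2" using F(4) n by linarith
    finally have "\<bar>\<Sum>x\<in>F. k (f, g) x\<bar> \<le> e * real n" using e by (simp add: abs_le_square_iff[symmetric])
    moreover have "(\<Sum>x\<in>F. k (f, g) x) = (\<Sum>x\<in>F. f (g x) - f x)"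
      using F(1) by (intro sum.cong) (auto simp: k_apply)
    ultimately show ?thesis using F(3) by (simp add: sum_subtractf)
  qed
  moreover have "F \<noteq> {}" using F(3) by (auto simp: n_def)
  ultimately show ?thesis using F(1,2) by (intro exI[of _ F]) auto
qed

text \<open>The functionals on \<open>UC_b X \<D>\<close> that lie between infimum and supremum form a product of compact
  intervals, and linearity and invariance up to \<open>e\<close> of a given pair are closed conditions. Averages
  over almost invariant finite sets satisfy any finitely many of them. A functional is total on
  the type \<open>'a \<Rightarrow> real\<close>; requiring the value zero outside \<open>UC_b X \<D>\<close> keeps the product over all of
  that type compact.\<close>

lemma almost_invariant_sets_imp_amenable:
  assumes D: "covering_uniformity X \<D>"
    and G: "\<And>g. g \<in> G \<Longrightarrow> uniformly_continuous_covering X \<D> X \<D> g"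
    and ai: "\<And>E H e. finite E \<Longrightarrow> E \<subseteq> G \<Longrightarrow> finite H \<Longrightarrow> H \<subseteq> UC_b X \<D> \<Longrightarrow> (0::real) < e \<Longrightarrow>
      \<exists>F. finite F \<and> F \<noteq> {} \<and> F \<subseteq> X \<and>
        (\<forall>g\<in>E. \<forall>f\<in>H. \<bar>(\<Sum>x\<in>F. f (g x)) - (\<Sum>x\<in>F. f x)\<bar> \<le> e * real (card F))"
  shows "amenable X \<D> G"
proof -
  let ?UC = "UC_b X \<D>"
  define B where "B f = (if f \<in> ?UC then {(INF x\<in>X. f x)..(SUP x\<in>X. f x)} else {0::real})" for f
  define Add where "Add = (\<lambda>(f, h). {\<nu> :: ('a \<Rightarrow> real) \<Rightarrow> real. \<nu> (\<lambda>x\<in>X. f x + h x) = \<nu> f + \<nu> h})"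
  define Scale where "Scale = (\<lambda>(c, f). {\<nu> :: ('a \<Rightarrow> real) \<Rightarrow> real. \<nu> (\<lambda>x\<in>X. c * f x) = c * \<nu> f})"
  define L where "L = (\<Inter>p\<in>?UC \<times> ?UC. Add p) \<inter> (\<Inter>p\<in>UNIV \<times> ?UC. Scale p)"
  define Z where "Z = (\<lambda>(g, f, e). {\<nu> :: ('a \<Rightarrow> real) \<Rightarrow> real. \<bar>\<nu> (compose X f g) - \<nu> f\<bar> \<le> e})"
  have cont: "continuous_on UNIV (\<lambda>\<nu> :: ('a \<Rightarrow> real) \<Rightarrow> real. \<nu> f)" for f
    by (rule continuous_on_product_coordinates)
  have "compactin (product_topology (\<lambda>_. euclidean) UNIV) (PiE UNIV B)"
    unfolding compactin_PiE by (auto simp: B_def)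
  then have "compact (PiE UNIV B)" unfolding euclidean_product_topology by simp
  moreover have "closed L"
  proof -
    have "closed (Add p)" for p
      unfolding Add_def by (cases p) (auto intro!: closed_Collect_eq continuous_intros cont)
    moreover have "closed (Scale p)" for p
      unfolding Scale_def by (cases p) (auto intro!: closed_Collect_eq continuous_intros cont)
    ultimately show ?thesis unfolding L_def by (intro closed_Int closed_INT) auto
  qed
  ultimately have comp: "compact (PiE UNIV B \<inter> L)" by (rule compact_Int_closed)
  have "PiE UNIV B \<inter> L \<inter> (\<Inter>i\<in>G \<times> ?UC \<times> {0<..}. Z i) \<noteq> {}"
  proof (rule compact_imp_fip_image[OF comp])
    show "closed (Z i)" for i
      unfolding Z_def by (cases i) (auto intro!: closed_Collect_le continuous_intros cont)
    fix I' assume I': "finite I'" "I' \<subseteq> G \<times> ?UC \<times> {0::real<..}"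
    define E where "E = fst ` I'"
    define H where "H = (fst \<circ> snd) ` I'"
    define e where "e = Min (insert 1 ((snd \<circ> snd) ` I'))"
    have e: "0 < e" unfolding e_def using I' by (subst Min_gr_iff) auto
    have fin: "finite E" "finite H" using I'(1) by (auto simp: E_def H_def)
    have sub: "E \<subseteq> G" "H \<subseteq> ?UC" using I'(2) by (auto simp: E_def H_def)
    obtain F where F: "finite F" "F \<noteq> {}" "F \<subseteq> X"
      and inv: "\<And>f g. g \<in> E \<Longrightarrow> f \<in> H \<Longrightarrow>
        \<bar>(\<Sum>x\<in>F. f (g x)) - (\<Sum>x\<in>F. f x)\<bar> \<le> e * real (card F)"
      using ai[OF fin(1) sub(1) fin(2) sub(2) e] by auto
    have c: "0 < real (card F)" using F(1,2) by (simp add: card_gt_0_iff)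
    define \<nu> where "\<nu> f = (if f \<in> ?UC then (\<Sum>x\<in>F. f x) / real (card F) else 0)" for f
    have \<nu>: "\<nu> (\<lambda>x\<in>X. h x) = (\<Sum>x\<in>F. h x) / real (card F)" if "(\<lambda>x\<in>X. h x) \<in> ?UC" for h
    proof -
      have "(\<Sum>x\<in>F. (\<lambda>x\<in>X. h x) x) = (\<Sum>x\<in>F. h x)" using F(3) by (intro sum.cong) auto
      then show ?thesis unfolding \<nu>_def using that by simp
    qed
    have "\<nu> f \<in> B f" for f
    proof (cases "f \<in> ?UC")
      case True
      then have bd: "bounded (f ` X)" unfolding UC_b_iff[OF D] by simp
      have "(\<Sum>x\<in>F. f x) \<le> real (card F) * (SUP x\<in>X. f x)"
        using F(3) bd by (intro sum_bounded_above cSUP_upper bounded_imp_bdd_above) auto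
      moreover have "real (card F) * (INF x\<in>X. f x) \<le> (\<Sum>x\<in>F. f x)"
        using F(3) bd by (intro sum_bounded_below cINF_lower bounded_imp_bdd_below) auto
      ultimately show ?thesis using True c by (simp add: B_def \<nu>_def field_simps)
    qed (simp add: B_def \<nu>_def)
    then have "\<nu> \<in> PiE UNIV B" by (simp add: PiE_def)
    moreover have "\<nu> \<in> Add (f, h)" if "f \<in> ?UC" "h \<in> ?UC" for f h
      using \<nu>[OF UC_b_add[OF D that]] that
      by (simp add: Add_def \<nu>_def sum.distrib add_divide_distrib)
    moreover have "\<nu> \<in> Scale (a, f)" if "f \<in> ?UC" for a f
      using \<nu>[OF UC_b_scale[OF D that]] that
      by (simp add: Scale_def \<nu>_def sum_distrib_left)
    moreover have "\<nu> \<in> Z i" if i: "i \<in> I'" for i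
    proof -
      obtain g f r where gfr: "i = (g, f, r)" by (cases i)
      have g: "g \<in> G" "g \<in> E" and f: "f \<in> ?UC" "f \<in> H"
        using i I'(2) gfr by (auto simp: E_def H_def image_iff intro!: bexI[of _ i])
      have "e \<le> r" unfolding e_def using i I'(1) gfr by (intro Min_le) (auto simp: image_iff intro!: bexI[of _ i])
      have "\<nu> (compose X f g) = (\<Sum>x\<in>F. f (g x)) / real (card F)"
        using \<nu>[of "\<lambda>x. f (g x)"] UC_b_compose[OF D f(1) G[OF g(1)]] by (simp add: compose_def)
      then have "\<bar>\<nu> (compose X f g) - \<nu> f\<bar> = \<bar>(\<Sum>x\<in>F. f (g x)) - (\<Sum>x\<in>F. f x)\<bar> / real (card F)"
        using f(1) c by (simp add: \<nu>_def diff_divide_distrib[symmetric])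
      also have "\<dots> \<le> e" using inv[OF g(2) f(2)] c by (simp add: field_simps)
      also note \<open>e \<le> r\<close>
      finally show ?thesis unfolding Z_def gfr by simp
    qed
    ultimately have "\<nu> \<in> PiE UNIV B \<inter> L \<inter> (\<Inter>i\<in>I'. Z i)" unfolding L_def by auto
    then show "PiE UNIV B \<inter> L \<inter> (\<Inter>i\<in>I'. Z i) \<noteq> {}" by auto
  qed
  then obtain \<nu> where \<nu>: "\<nu> \<in> PiE UNIV B" "\<nu> \<in> L" "\<nu> \<in> (\<Inter>i\<in>G \<times> ?UC \<times> {0<..}. Z i)" by auto
  have "mean X \<D> \<nu>"
    unfolding mean_def
  proof (intro conjI ballI allI)
    fix f assume f: "f \<in> ?UC"
    have "\<nu> f \<in> B f" using \<nu>(1) by (auto simp: PiE_def)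
    then show "(INF x\<in>X. f x) \<le> \<nu> f" "\<nu> f \<le> (SUP x\<in>X. f x)" using f by (auto simp: B_def)
    fix h assume h: "h \<in> ?UC"
    have "\<nu> \<in> Add (f, h)" using \<nu>(2) f h unfolding L_def by auto
    then show "\<nu> (\<lambda>x\<in>X. f x + h x) = \<nu> f + \<nu> h" by (simp add: Add_def)
  next
    fix c f assume f: "f \<in> ?UC"
    have "\<nu> \<in> Scale (c, f)" using \<nu>(2) f unfolding L_def by auto
    then show "\<nu> (\<lambda>x\<in>X. c * f x) = c * \<nu> f" by (simp add: Scale_def)
  qed
  moreover have "\<nu> (compose X f g) = \<nu> f" if fg: "f \<in> ?UC" "g \<in> G" for f g
  proof -
    have "\<bar>\<nu> (compose X f g) - \<nu> f\<bar> \<le> 0 + e" if "0 < e" for e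
    proof -
      have "\<nu> \<in> Z (g, f, e)" using \<nu>(3) fg that by auto
      then show ?thesis by (simp add: Z_def)
    qed
    then have "\<bar>\<nu> (compose X f g) - \<nu> f\<bar> \<le> 0" by (rule field_le_epsilon)
    then show ?thesis by simp
  qed
  ultimately show ?thesis unfolding amenable_def by auto
qed

section \<open>Almost invariance and matchings\<close>

text \<open>For \<open>S \<subseteq> F\<close> let \<open>\<V>\<close> be the members of \<open>\<U>\<close> that meet \<open>S\<close>. A function that is one at the
  points that lie in no member of \<open>\<U>\<close> outside \<open>\<V>\<close>, in particular on \<open>S\<close>, and zero off
  \<open>\<Union>\<V>\<close> compares \<open>card S\<close> with the number of points of \<open>g ` F\<close> adjacent to \<open>S\<close>. The functions are
  indexed by the families \<open>\<V>\<close> and not by the sets \<open>S\<close>, so that a finite \<open>\<U>\<close> requires only finitely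
  many of them.\<close>

lemma almost_invariant_imp_matching:
  assumes F: "finite F" "F \<subseteq> X" and g: "inj_on g F" "g ` F \<subseteq> X"
    and f: "\<And>\<V> x. \<V> \<subseteq> \<U> \<Longrightarrow> x \<in> X \<Longrightarrow> 0 \<le> f \<V> x \<and> f \<V> x \<le> (1::real)"
    and one: "\<And>\<V> x. \<V> \<subseteq> \<U> \<Longrightarrow> x \<in> X \<Longrightarrow> (\<forall>U\<in>\<U>. x \<in> U \<longrightarrow> U \<in> \<V>) \<Longrightarrow> f \<V> x = 1"
    and zero: "\<And>\<V> x. \<V> \<subseteq> \<U> \<Longrightarrow> x \<in> X \<Longrightarrow> x \<notin> \<Union>\<V> \<Longrightarrow> f \<V> x = 0"
    and e: "0 \<le> e"
    and inv: "\<And>\<V>. \<V> \<subseteq> \<U> \<Longrightarrow> \<bar>(\<Sum>x\<in>F. f \<V> (g x)) - (\<Sum>x\<in>F. f \<V> x)\<bar> \<le> e * real (card F)"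
  shows "(1 - e) * real (card F) \<le> real (matching_number F (g ` F) \<U>)"
proof -
  define N where "N x = {y \<in> g ` F. \<exists>U\<in>\<U>. {x, y} \<subseteq> U}" for x
  \<comment> \<open>rounding down loses nothing, as the counting condition is between integers\<close>
  define d where "d = nat \<lfloor>e * real (card F)\<rfloor>"
  have finN: "finite (N x)" for x unfolding N_def using F(1) by simp
  have "card S \<le> card (\<Union>(N ` S)) + d" if S: "S \<subseteq> F" for S
  proof -
    define \<V> where "\<V> = {U \<in> \<U>. U \<inter> S \<noteq> {}}"
    have V: "\<V> \<subseteq> \<U>" by (auto simp: \<V>_def)
    have UN: "\<Union>(N ` S) = g ` F \<inter> \<Union>\<V>" unfolding N_def \<V>_def by auto
    have "f \<V> x = 1" if "x \<in> S" for x
      using that S F(2) by (intro one[OF V]) (auto simp: \<V>_def)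
    then have "real (card S) = (\<Sum>x\<in>S. f \<V> x)" by simp
    also have "\<dots> \<le> (\<Sum>x\<in>F. f \<V> x)"
      using S F f[OF V] by (intro sum_mono2) auto
    also have "\<dots> \<le> (\<Sum>x\<in>F. f \<V> (g x)) + e * real (card F)" using inv[OF V] by linarith
    also have "(\<Sum>x\<in>F. f \<V> (g x)) = (\<Sum>y\<in>g ` F. f \<V> y)" by (simp add: sum.reindex[OF g(1)])
    also have "\<dots> \<le> (\<Sum>y\<in>g ` F. of_bool (y \<in> \<Union>\<V>))"
    proof (rule sum_mono)
      fix y assume "y \<in> g ` F"
      then have y: "y \<in> X" using g(2) by auto
      show "f \<V> y \<le> of_bool (y \<in> \<Union>\<V>)"
        using f[OF V y] zero[OF V y] by (cases "y \<in> \<Union>\<V>") auto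
    qed
    also have "\<dots> = real (card (\<Union>(N ` S)))" unfolding UN using F(1) by (simp add: sum_of_bool_eq Int_def)
    finally show ?thesis unfolding d_def by linarith
  qed
  then obtain D \<phi> where D: "D \<subseteq> F" "inj_on \<phi> D" "\<forall>x\<in>D. \<phi> x \<in> N x" "card F \<le> card D + d"
    using hall_deficiency[of F N d, OF F(1) finN] by auto
  have "card D \<le> matching_number F (g ` F) \<U>"
    using D by (intro matching_number_ge[OF F(1)]) (auto simp: N_def)
  moreover have "real d \<le> e * real (card F)" unfolding d_def using e by simp
  ultimately show ?thesis using D(4) by (simp add: algebra_simps)
qed

lemma matching_imp_almost_invariant:
  assumes D: "covering_uniformity X \<D>" and H: "finite H" "H \<subseteq> UC_b X \<D>" and e: "0 < e"
  obtains \<theta> \<U> where "0 \<le> \<theta>" "\<theta> < (1::real)" "\<U> \<in> \<D>" "finite \<U>"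
    "\<And>F g f. finite F \<Longrightarrow> F \<subseteq> X \<Longrightarrow> inj_on g F \<Longrightarrow> g ` F \<subseteq> X \<Longrightarrow>
      \<theta> * real (card F) \<le> real (matching_number F (g ` F) \<U>) \<Longrightarrow> f \<in> H \<Longrightarrow>
      \<bar>(\<Sum>x\<in>F. f (g x)) - (\<Sum>x\<in>F. f x)\<bar> \<le> e * real (card F)"
proof -
  have "bounded (\<Union>f\<in>H. f ` X)"
    using H unfolding UC_b_iff[OF D] subset_iff by (intro bounded_UN) auto
  then obtain M where "0 < M" and M: "\<And>f x. f \<in> H \<Longrightarrow> x \<in> X \<Longrightarrow> \<bar>f x\<bar> \<le> M"
    unfolding bounded_pos by auto
  have "0 < e/2" using e by simp
  from finite_uniform_covering_small_oscillation[OF D H this]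
  obtain \<U> where U: "\<U> \<in> \<D>" "finite \<U>"
    and osc: "\<forall>f\<in>H. \<forall>u\<in>\<U>. \<forall>x\<in>u. \<forall>y\<in>u. \<bar>f x - f y\<bar> < e/2"
    by (elim bexE conjE)
  \<comment> \<open>the matched points contribute at most \<open>e/2\<close> each, the unmatched ones \<open>2 * M * t \<le> e/2\<close> on average\<close>
  define t where "t = min 1 (e / (4 * M))"
  have t: "0 < t" "t \<le> 1" "2 * M * t \<le> e/2"
    using e \<open>0 < M\<close> by (auto simp: t_def min_def field_simps)
  show thesis
  proof (rule that[of "1 - t" \<U>])
    fix F g f
    assume F: "finite F" "F \<subseteq> X" and g: "inj_on g F" "g ` F \<subseteq> X" and f: "f \<in> H"
      and m: "(1 - t) * real (card F) \<le> real (matching_number F (g ` F) \<U>)"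
    let ?m = "real (matching_number F (g ` F) \<U>)" and ?n = "real (card F)"
    have le: "?m \<le> ?n"
      using matching_number_attained[OF F(1), of "g ` F" \<U>] card_mono[OF F(1)] by (metis of_nat_le_iff)
    have "\<bar>(\<Sum>x\<in>F. f x) - (\<Sum>x\<in>g ` F. f x)\<bar> \<le> ?m * (e/2) + 2 * M * (?n - ?m)"
    proof (rule sum_diff_le_matching_number)
      show "\<bar>f x\<bar> \<le> M" if "x \<in> F \<union> g ` F" for x using that M[OF f] F(2) g(2) by auto
      show "\<bar>f x - f y\<bar> \<le> e/2" if "u \<in> \<U>" "x \<in> u" "y \<in> u" for u x y
        using osc f that by (intro less_imp_le) simp
    qed (use F g card_image in auto)
    also have "?m * (e/2) \<le> ?n * (e/2)" using le e by (intro mult_right_mono) auto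
    also have "2 * M * (?n - ?m) \<le> 2 * M * (t * ?n)"
      using m \<open>0 < M\<close> by (intro mult_left_mono) (auto simp: algebra_simps)
    also have "\<dots> = (2 * M * t) * ?n" by simp
    also have "\<dots> \<le> (e/2) * ?n" using t(3) by (rule mult_right_mono) simp
    finally have "\<bar>(\<Sum>x\<in>F. f x) - (\<Sum>x\<in>g ` F. f x)\<bar> \<le> e * ?n" by (simp add: algebra_simps)
    then show "\<bar>(\<Sum>x\<in>F. f (g x)) - (\<Sum>x\<in>F. f x)\<bar> \<le> e * ?n"
      by (simp add: sum.reindex[OF g(1)] abs_minus_commute)
  qed (use t U in auto)
qed

theorem corollary5p3:
  fixes X :: "'a set" and \<D> :: "'a set set set" and G :: "('a \<Rightarrow> 'a) set"
  assumes "covering_uniform_space X \<D>"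
    and "Hausdorff_space (uniform_topology X \<D>)"
    and "perfect_space (uniform_topology X \<D>)"
    and "subgroup G (Aut X \<D>)"
  shows "amenable X \<D> G \<longleftrightarrow>
    (\<forall>\<theta>::real. 0 \<le> \<theta> \<and> \<theta> < 1 \<longrightarrow>
      (\<forall>E. finite E \<and> E \<subseteq> G \<longrightarrow>
        (\<forall>\<U>. \<U> \<in> \<D> \<and> finite \<U> \<longrightarrow>
          (\<exists>F. finite F \<and> F \<noteq> {} \<and> F \<subseteq> X \<and>
            (\<forall>g\<in>E. real (matching_number F (g ` F) \<U>) \<ge> \<theta> * real (card F))))))"
    (is "_ \<longleftrightarrow> ?matching")
proof -
  have D: "covering_uniformity X \<D>" and X: "X \<noteq> {}"
    using assms(1) by (auto simp: covering_uniform_space_def)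
  have G: "g \<in> Bij X \<and> uniformly_continuous_covering X \<D> X \<D> g" if "g \<in> G" for g
    using subgroup.subset[OF assms(4)] that by (auto simp: Aut_def)
  have inj: "inj_on g F" and im: "g ` F \<subseteq> X" if "g \<in> G" "F \<subseteq> X" for g F
    using G[OF that(1)] that(2) by (auto simp: Bij_def bij_betw_def intro: inj_on_subset)
  show ?thesis
  proof
    assume "amenable X \<D> G"
    then obtain \<nu> where \<nu>: "mean X \<D> \<nu>" "\<And>f g. f \<in> UC_b X \<D> \<Longrightarrow> g \<in> G \<Longrightarrow> \<nu> (compose X f g) = \<nu> f"
      unfolding amenable_def by auto
    show ?matching
    proof (intro allI impI, elim conjE)
      fix \<theta> :: real and E \<U>
      assume \<theta>: "0 \<le> \<theta>" "\<theta> < 1" and E: "finite E" "E \<subseteq> G" and U: "\<U> \<in> \<D>" "finite \<U>"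
      \<comment> \<open>the star of \<open>core \<V>\<close> with respect to \<open>\<U>\<close> is contained in \<open>\<Union>\<V>\<close>\<close>
      define core where "core \<V> = {x \<in> X. \<forall>U\<in>\<U>. x \<in> U \<longrightarrow> U \<in> \<V>}" for \<V>
      have "\<exists>f. f \<in> UC_b X \<D> \<and> (\<forall>x\<in>X. 0 \<le> f x \<and> f x \<le> 1) \<and> (\<forall>x\<in>core \<V>. f x = 1) \<and>
          (\<forall>x\<in>X. x \<notin> star (core \<V>) \<U> \<longrightarrow> f x = 0)" for \<V>
        by (rule uniform_urysohn[OF D U(1), of "core \<V>"]) (auto simp: core_def)
      then obtain f where f: "\<And>\<V>. f \<V> \<in> UC_b X \<D>" "\<And>\<V> x. x \<in> X \<Longrightarrow> 0 \<le> f \<V> x \<and> f \<V> x \<le> 1"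
          "\<And>\<V> x. x \<in> core \<V> \<Longrightarrow> f \<V> x = 1" "\<And>\<V> x. x \<in> X \<Longrightarrow> x \<notin> star (core \<V>) \<U> \<Longrightarrow> f \<V> x = 0"
        by metis
      have "\<exists>F. finite F \<and> F \<noteq> {} \<and> F \<subseteq> X \<and> (\<forall>g\<in>E. \<forall>h\<in>f ` Pow \<U>.
          \<bar>(\<Sum>x\<in>F. h (g x)) - (\<Sum>x\<in>F. h x)\<bar> \<le> (1 - \<theta>) * real (card F))"
        using \<nu>(2) E G U(2) f(1,2) \<theta>(2)
        by (intro invariant_mean_imp_almost_invariant_sets[OF D X assms(2,3) \<nu>(1)]) auto
      then obtain F where F: "finite F" "F \<noteq> {}" "F \<subseteq> X" and
        inv_all: "\<forall>g\<in>E. \<forall>h\<in>f ` Pow \<U>.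
          \<bar>(\<Sum>x\<in>F. h (g x)) - (\<Sum>x\<in>F. h x)\<bar> \<le> (1 - \<theta>) * real (card F)"
        by (elim exE conjE)
      have inv: "\<bar>(\<Sum>x\<in>F. f \<V> (g x)) - (\<Sum>x\<in>F. f \<V> x)\<bar> \<le> (1 - \<theta>) * real (card F)"
        if "g \<in> E" "\<V> \<subseteq> \<U>" for g \<V>
        using inv_all that by simp
      have "\<theta> * real (card F) \<le> real (matching_number F (g ` F) \<U>)" if g: "g \<in> E" for g
      proof -
        have gG: "g \<in> G" using g E(2) by auto
        have "(1 - (1 - \<theta>)) * real (card F) \<le> real (matching_number F (g ` F) \<U>)"
        proof (rule almost_invariant_imp_matching[OF F(1,3) inj[OF gG F(3)] im[OF gG F(3)], of \<U> f])
          fix \<V> x assume x: "x \<in> X"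
          show "0 \<le> f \<V> x \<and> f \<V> x \<le> 1" by (rule f(2)[OF x])
          show "f \<V> x = 1" if "\<forall>U\<in>\<U>. x \<in> U \<longrightarrow> U \<in> \<V>" using that x by (intro f(3)) (simp add: core_def)
          show "f \<V> x = 0" if "x \<notin> \<Union>\<V>"
          proof (rule f(4)[OF x])
            have "star (core \<V>) \<U> \<subseteq> \<Union>\<V>" unfolding star_def core_def by auto
            then show "x \<notin> star (core \<V>) \<U>" using that by auto
          qed
        qed (use \<theta> inv[OF g] in auto)
        then show ?thesis by simp
      qed
      then show "\<exists>F. finite F \<and> F \<noteq> {} \<and> F \<subseteq> X \<and>
          (\<forall>g\<in>E. real (matching_number F (g ` F) \<U>) \<ge> \<theta> * real (card F))"
        using F by (intro exI[of _ F]) auto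
    qed
  next
    assume R: ?matching
    show "amenable X \<D> G"
    proof (rule almost_invariant_sets_imp_amenable[OF D])
      show "uniformly_continuous_covering X \<D> X \<D> g" if "g \<in> G" for g using G[OF that] ..
      fix E H and e :: real
      assume E: "finite E" "E \<subseteq> G" and H: "finite H" "H \<subseteq> UC_b X \<D>" and e: "0 < e"
      obtain \<theta> \<U> where \<theta>: "0 \<le> \<theta>" "\<theta> < (1::real)" and U: "\<U> \<in> \<D>" "finite \<U>"
        and main: "\<And>F g f. finite F \<Longrightarrow> F \<subseteq> X \<Longrightarrow> inj_on g F \<Longrightarrow> g ` F \<subseteq> X \<Longrightarrow>
          \<theta> * real (card F) \<le> real (matching_number F (g ` F) \<U>) \<Longrightarrow> f \<in> H \<Longrightarrow>
          \<bar>(\<Sum>x\<in>F. f (g x)) - (\<Sum>x\<in>F. f x)\<bar> \<le> e * real (card F)"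
        by (rule matching_imp_almost_invariant[OF D H e]) (rule that)
      obtain F where F: "finite F" "F \<noteq> {}" "F \<subseteq> X"
        "\<forall>g\<in>E. real (matching_number F (g ` F) \<U>) \<ge> \<theta> * real (card F)"
        using R \<theta> E U by meson
      have "\<bar>(\<Sum>x\<in>F. f (g x)) - (\<Sum>x\<in>F. f x)\<bar> \<le> e * real (card F)" if "g \<in> E" "f \<in> H" for f g
      proof -
        have g: "g \<in> G" using that(1) E(2) by auto
        show ?thesis using main[OF F(1,3) inj[OF g F(3)] im[OF g F(3)] _ that(2)] F(4) that(1) by auto
      qed
      then show "\<exists>F. finite F \<and> F \<noteq> {} \<and> F \<subseteq> X \<and>
          (\<forall>g\<in>E. \<forall>f\<in>H. \<bar>(\<Sum>x\<in>F. f (g x)) - (\<Sum>x\<in>F. f x)\<bar> \<le> e * real (card F))"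
        using F by (intro exI[of _ F]) auto
    qed
  qed
qed

end
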